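(* Let $f_1,f_2\in A_\mathbb{R}(\mathbb{D})$ with $\|f_1\|_\infty\le 1$, $\|f_2\|_\infty\le 1$, suppose $f_1$ is POZ of $f_2$, and suppose $$\inf_{z\in\overline{\mathbb{D}}}\big(|f_1(z)|+|f_2(z)|\big)=\delta>0.$$ Then there exist $g_1,g_2\in A_\mathbb{R}(\mathbb{D})$ such that $g_1^{-1}\in A_\mathbb{R}(\mathbb{D})$ (i.e. $g_1$ has no zeros on $\overline{\mathbb{D}}$) and $$f_1(z)g_1(z)+f_2(z)g_2(z)=1\quad\text{for all } z\in\overline{\mathbb{D}}.$$
   Context: $\mathbb{D}$ is the open unit disc in $\mathbb{C}$. $A(\mathbb{D})$ (the disc algebra) is the set of functions continuous on $\overline{\mathbb{D}}$ and holomorphic on $\mathbb{D}$. $A_\mathbb{R}(\mathbb{D})$ is the set of $f\in A(\mathbb{D})$ with real Fourier (Taylor) coefficients, equivalently satisfying the real-symmetry condition $f(z)=\overline{f(\overline{z})}$ for all $z\in\overline{\mathbb{D}}$; in particular such $f$ are real-valued on $[-1,1]$. $\|f\|_\infty=\sup_{\overline{\mathbb{D}}}|f|$. For $f_1,f_2\in A_\mathbb{R}(\mathbb{D})$ we say "$f_1$ is POZ of $f_2$" (positive on real zeros) if $f_1$ takes values of the same sign at all real zeros of $f_2$, i.e. at all points $\lambda\in[-1,1]$ with $f_2(\lambda)=0$. *)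

theory Defs
  imports "HOL-Analysis.Analysis"
begin

definition disc_algebra :: "(complex \<Rightarrow> complex) set" where
  "disc_algebra = {f. continuous_on (cball 0 1) f \<and> f holomorphic_on ball 0 1}"

definition real_disc_algebra :: "(complex \<Rightarrow> complex) set" where
  "real_disc_algebra = {f. f \<in> disc_algebra \<and> (\<forall>z\<in>cball 0 1. f z = cnj (f (cnj z)))}"

definition sup_norm_disc :: "(complex \<Rightarrow> complex) \<Rightarrow> real" where
  "sup_norm_disc f = (SUP z\<in>cball 0 1. cmod (f z))"

text \<open>f1 is POZ of f2: f1 takes values of the same (strict) sign at all real zeros of f2
  in [-1,1]. (f1 is real-valued on [-1,1], so the sign refers to Re.)\<close>
definition POZ :: "(complex \<Rightarrow> complex) \<Rightarrow> (complex \<Rightarrow> complex) \<Rightarrow> bool" where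
  "POZ f1 f2 \<longleftrightarrow>
     (\<forall>t::real. -1 \<le> t \<and> t \<le> 1 \<and> f2 (complex_of_real t) = 0 \<longrightarrow> Re (f1 (complex_of_real t)) > 0) \<or>
     (\<forall>t::real. -1 \<le> t \<and> t \<le> 1 \<and> f2 (complex_of_real t) = 0 \<longrightarrow> Re (f1 (complex_of_real t)) < 0)"

end

theory Submission
  imports Defs "HOL-Complex_Analysis.Complex_Analysis"
    "HOL-Computational_Algebra.Fundamental_Theorem_Algebra"
begin

text \<open>It suffices to write \<open>f1 = u + h f2\<close> with a unit \<open>u\<close>, i.e. to show that \<open>f1\<close> is congruent to a
  unit modulo \<open>f2\<close>. If \<open>x p + y f2 = 1\<close> and \<open>q\<close> is so close to \<open>p\<close> that \<open>\<bar>x (q - p)\<bar> < 1\<close>, then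
  \<open>q \<equiv> p (1 + x (q - p))\<close> modulo \<open>f2\<close>, so \<open>p\<close> is congruent to a unit iff \<open>q\<close> is. Hence this property is
  invariant under homotopies through functions coprime to \<open>f2\<close>, and \<open>f1\<close> may be replaced by a polynomial
  with real coefficients. Its zeros are moved out of the disc: by the maximum principle the complement
  of the zero set of \<open>f2\<close> is connected, so conjugate pairs can escape; positivity at the real zeros
  of \<open>f2\<close> makes the number of real zeros of the polynomial in each bounded gap even, so two of them can
  be merged and then leave as a conjugate pair.

  Bezout equations come from the corona theorem for the disc algebra: if \<open>f1, f2\<close> have no common zero,
  every \<open>\<nu> - z\<close> is invertible modulo the ideal they generate. That the ideal is then everything is the
  Gelfand--Mazur theorem, proved here without integration: the averages \<open>F\<^sub>n(r)\<close> of \<open>\<nu> (\<nu> - z)\<inverse>\<close> over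
  the points \<open>\<nu> = r \<omega>\<close> with \<open>\<omega>\<^sup>n = 1\<close> equal \<open>(1 - (z/r)\<^sup>n)\<inverse>\<close> and are Lipschitz in \<open>r\<close> uniformly in
  \<open>n\<close>, so that smallness of \<open>(z/r)\<^sup>n\<close> for some \<open>n\<close> propagates from \<open>r = 2\<close> down to \<open>r = 0\<close>, where
  \<open>F\<^sub>n = 0\<close>.\<close>

section \<open>The disc algebra\<close>

lemma disc_algebra_const [simp, intro]: "(\<lambda>_. c) \<in> disc_algebra"
  by (simp add: disc_algebra_def)

lemma disc_algebra_ident [simp, intro]: "(\<lambda>z. z) \<in> disc_algebra"
  by (simp add: disc_algebra_def)

lemma disc_algebra_add [intro]:
  "f \<in> disc_algebra \<Longrightarrow> g \<in> disc_algebra \<Longrightarrow> (\<lambda>z. f z + g z) \<in> disc_algebra"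
  by (auto simp: disc_algebra_def intro: continuous_intros holomorphic_intros)

lemma disc_algebra_uminus [intro]: "f \<in> disc_algebra \<Longrightarrow> (\<lambda>z. - f z) \<in> disc_algebra"
  by (auto simp: disc_algebra_def intro: continuous_intros holomorphic_intros)

lemma disc_algebra_diff [intro]:
  "f \<in> disc_algebra \<Longrightarrow> g \<in> disc_algebra \<Longrightarrow> (\<lambda>z. f z - g z) \<in> disc_algebra"
  by (auto simp: disc_algebra_def intro: continuous_intros holomorphic_intros)

lemma disc_algebra_mult [intro]:
  "f \<in> disc_algebra \<Longrightarrow> g \<in> disc_algebra \<Longrightarrow> (\<lambda>z. f z * g z) \<in> disc_algebra"
  by (auto simp: disc_algebra_def intro: continuous_intros holomorphic_intros)

lemma disc_algebra_power [intro]: "f \<in> disc_algebra \<Longrightarrow> (\<lambda>z. f z ^ n) \<in> disc_algebra"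
  by (auto simp: disc_algebra_def intro: continuous_intros holomorphic_intros)

lemma disc_algebra_sum [intro]:
  "(\<And>i. i \<in> J \<Longrightarrow> f i \<in> disc_algebra) \<Longrightarrow> (\<lambda>z. \<Sum>i\<in>J. f i z) \<in> disc_algebra"
  by (auto simp: disc_algebra_def intro: continuous_intros holomorphic_intros)

lemma disc_algebra_divide:
  "f \<in> disc_algebra \<Longrightarrow> g \<in> disc_algebra \<Longrightarrow> (\<And>z. z \<in> cball 0 1 \<Longrightarrow> g z \<noteq> 0)
    \<Longrightarrow> (\<lambda>z. f z / g z) \<in> disc_algebra"
  by (auto simp: disc_algebra_def intro!: continuous_intros holomorphic_intros)

lemmas disc_algebra_intros = disc_algebra_const disc_algebra_ident disc_algebra_add disc_algebra_uminus
  disc_algebra_diff disc_algebra_mult disc_algebra_power disc_algebra_sum disc_algebra_divide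

lemma holomorphic_imp_disc_algebra:
  "f holomorphic_on S \<Longrightarrow> cball 0 1 \<subseteq> S \<Longrightarrow> f \<in> disc_algebra"
  unfolding disc_algebra_def
  by (metis (mono_tags, lifting) ball_subset_cball holomorphic_on_imp_continuous_on
      holomorphic_on_subset mem_Collect_eq)

lemma disc_algebra_bounded:
  assumes "f \<in> disc_algebra"
  obtains B where "B > 0" "\<And>z. z \<in> cball 0 1 \<Longrightarrow> cmod (f z) \<le> B"
proof -
  have "compact (f ` cball 0 1)"
    using assms by (intro compact_continuous_image) (auto simp: disc_algebra_def)
  then have "bounded (f ` cball 0 1)"
    by (rule compact_imp_bounded)
  then obtain B where "B > 0" "\<forall>w\<in>f ` cball 0 1. cmod w \<le> B"
    unfolding bounded_pos by blast
  then show thesis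
    by (intro that[of B]) auto
qed

lemma one_minus_nonzero:
  fixes w :: complex
  assumes "cmod w \<le> c" "c < 1"
  shows "1 - w \<noteq> 0" "1 + w \<noteq> 0"
proof -
  have "w \<noteq> 1" "w \<noteq> -1"
    using assms by auto
  then show "1 - w \<noteq> 0" "1 + w \<noteq> 0"
    by (auto simp: add_eq_0_iff)
qed

lemma norm_divide_one_minus:
  assumes "cmod w \<le> c" "c < 1"
  shows "cmod (w / (1 - w)) \<le> c / (1 - c)" "cmod (w / (1 + w)) \<le> c / (1 - c)"
proof -
  have 1: "1 - c \<le> cmod (1 - w)" "1 - c \<le> cmod (1 + w)"
    using assms norm_triangle_ineq2[of 1 w] norm_triangle_ineq2[of 1 "-w"] by auto
  have 2: "0 \<le> c" "0 < 1 - c"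
    using assms order_trans[OF norm_ge_zero assms(1)] by auto
  show "cmod (w / (1 - w)) \<le> c / (1 - c)"
    unfolding norm_divide by (rule frac_le[OF 2(1) assms(1) 2(2) 1(1)])
  show "cmod (w / (1 + w)) \<le> c / (1 - c)"
    unfolding norm_divide by (rule frac_le[OF 2(1) assms(1) 2(2) 1(2)])
qed

section \<open>Ideals with empty spectrum\<close>

text \<open>Functions are total on \<open>complex\<close>, but only their values on the closed disc
  matter; \<open>cong\<close> expresses this.\<close>

locale disc_ideal =
  fixes I :: "(complex \<Rightarrow> complex) set"
  assumes zero: "(\<lambda>_. 0) \<in> I"
    and add: "f \<in> I \<Longrightarrow> g \<in> I \<Longrightarrow> (\<lambda>z. f z + g z) \<in> I"
    and mult: "a \<in> disc_algebra \<Longrightarrow> f \<in> I \<Longrightarrow> (\<lambda>z. a z * f z) \<in> I"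
    and cong: "f \<in> I \<Longrightarrow> (\<And>z. z \<in> cball 0 1 \<Longrightarrow> g z = f z) \<Longrightarrow> g \<in> I"
begin

lemma comb:
  assumes "f \<in> I" "g \<in> I" "a \<in> disc_algebra" "b \<in> disc_algebra"
    and "\<And>z. z \<in> cball 0 1 \<Longrightarrow> k z = a z * f z + b z * g z"
  shows "k \<in> I"
  by (rule cong[OF add[OF mult[OF assms(3,1)] mult[OF assms(4,2)]]]) (use assms(5) in auto)

lemma sum_mem:
  assumes "finite J" "\<And>j. j \<in> J \<Longrightarrow> f j \<in> I"
  shows "(\<lambda>z. \<Sum>j\<in>J. f j z) \<in> I"
  using assms by (induction J rule: finite_induct) (auto simp: zero intro: add)

text \<open>A bound on the quotient norm modulo \<open>I\<close>, witnessed by an actual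
  representative, so that neither infima nor a quotient type enter.\<close>

definition small :: "real \<Rightarrow> (complex \<Rightarrow> complex) \<Rightarrow> bool" where
  "small c g \<longleftrightarrow> (\<exists>h\<in>disc_algebra. (\<forall>z\<in>cball 0 1. cmod (h z) \<le> c) \<and> (\<lambda>z. g z - h z) \<in> I)"

lemma smallI:
  "h \<in> disc_algebra \<Longrightarrow> (\<And>z. z \<in> cball 0 1 \<Longrightarrow> cmod (h z) \<le> c) \<Longrightarrow> (\<lambda>z. g z - h z) \<in> I \<Longrightarrow> small c g"
  unfolding small_def by blast

lemma smallE:
  assumes "small c g"
  obtains h where "h \<in> disc_algebra" "\<And>z. z \<in> cball 0 1 \<Longrightarrow> cmod (h z) \<le> c" "(\<lambda>z. g z - h z) \<in> I"
  using assms unfolding small_def by blast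

lemma small_bound: "h \<in> disc_algebra \<Longrightarrow> (\<And>z. z \<in> cball 0 1 \<Longrightarrow> cmod (h z) \<le> c) \<Longrightarrow> small c h"
  by (rule smallI[of h]) (auto simp: zero)

lemma small_mono: "small c g \<Longrightarrow> c \<le> d \<Longrightarrow> small d g"
  unfolding small_def by (meson order_trans)

lemma small_nonneg: "small c g \<Longrightarrow> 0 \<le> c"
  unfolding small_def by (meson centre_in_cball norm_ge_zero order_trans zero_le_one)

lemma small_cong:
  assumes "small c f" "\<And>z. z \<in> cball 0 1 \<Longrightarrow> g z = f z"
  shows "small c g"
proof -
  obtain h where h: "h \<in> disc_algebra" "\<And>z. z \<in> cball 0 1 \<Longrightarrow> cmod (h z) \<le> c" "(\<lambda>z. f z - h z) \<in> I"
    using assms(1) by (rule smallE) blast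
  show ?thesis
    by (rule smallI[OF h(1,2)]) (auto intro!: cong[OF h(3)] simp: assms(2))
qed

lemma small_add:
  assumes "small c f" "small d g"
  shows "small (c + d) (\<lambda>z. f z + g z)"
proof -
  obtain h where h: "h \<in> disc_algebra" "\<And>z. z \<in> cball 0 1 \<Longrightarrow> cmod (h z) \<le> c" "(\<lambda>z. f z - h z) \<in> I"
    using assms(1) by (rule smallE) blast
  obtain k where k: "k \<in> disc_algebra" "\<And>z. z \<in> cball 0 1 \<Longrightarrow> cmod (k z) \<le> d" "(\<lambda>z. g z - k z) \<in> I"
    using assms(2) by (rule smallE) blast
  show ?thesis
  proof (rule smallI)
    show "(\<lambda>z. h z + k z) \<in> disc_algebra" using h k by auto
    show "cmod (h z + k z) \<le> c + d" if "z \<in> cball 0 1" for z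
      using h(2)[OF that] k(2)[OF that] by (rule norm_triangle_mono)
    show "(\<lambda>z. f z + g z - (h z + k z)) \<in> I"
      by (rule comb[OF h(3) k(3), of "\<lambda>_. 1" "\<lambda>_. 1"]) auto
  qed
qed

text \<open>With representatives \<open>h\<close>, \<open>k\<close>:
  \<open>f g - h k = k (f - h) + f (g - k)\<close>, where \<open>f\<close> acts as a multiplier and
  so has to lie in the algebra.\<close>

lemma small_mult:
  assumes "small c f" "small d g" "f \<in> disc_algebra"
  shows "small (c * d) (\<lambda>z. f z * g z)"
proof -
  obtain h where h: "h \<in> disc_algebra" "\<And>z. z \<in> cball 0 1 \<Longrightarrow> cmod (h z) \<le> c" "(\<lambda>z. f z - h z) \<in> I"
    using assms(1) by (rule smallE) blast
  obtain k where k: "k \<in> disc_algebra" "\<And>z. z \<in> cball 0 1 \<Longrightarrow> cmod (k z) \<le> d" "(\<lambda>z. g z - k z) \<in> I"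
    using assms(2) by (rule smallE) blast
  show ?thesis
  proof (rule smallI)
    show "(\<lambda>z. h z * k z) \<in> disc_algebra" using h k by auto
    show "cmod (h z * k z) \<le> c * d" if "z \<in> cball 0 1" for z
      using h(2)[OF that] k(2)[OF that] small_nonneg[OF assms(1)]
      by (simp add: norm_mult mult_mono)
    show "(\<lambda>z. f z * g z - h z * k z) \<in> I"
      by (rule comb[OF h(3) k(3) k(1) assms(3)]) (auto simp: algebra_simps)
  qed
qed

lemma small_power:
  assumes "small c f" "f \<in> disc_algebra"
  shows "small (c ^ n) (\<lambda>z. f z ^ n)"
proof (induction n)
  case 0
  show ?case by (auto intro: small_bound)
next
  case (Suc n)
  show ?case using small_mult[OF assms(1) Suc assms(2)] by simp
qed

lemma small_sum:
  assumes "finite J" "\<And>j. j \<in> J \<Longrightarrow> small (c j) (f j)"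
  shows "small (\<Sum>j\<in>J. c j) (\<lambda>z. \<Sum>j\<in>J. f j z)"
  using assms
proof (induction J rule: finite_induct)
  case empty
  show ?case by (auto intro: small_bound)
next
  case (insert x F)
  then show ?case using small_add[of "c x" "f x"] by auto
qed

text \<open>\<open>1 - h\<close> lies in \<open>I\<close> and has no zero on the closed disc, so it
  is a unit of the algebra.\<close>

lemma one_mem_if_small:
  assumes "small c (\<lambda>_. 1)" "c < 1"
  shows "(\<lambda>_. 1) \<in> I"
proof -
  obtain h where h: "h \<in> disc_algebra" "\<And>z. z \<in> cball 0 1 \<Longrightarrow> cmod (h z) \<le> c" "(\<lambda>z. 1 - h z) \<in> I"
    using assms(1) by (rule smallE) blast
  have nz: "1 - h z \<noteq> 0" if "z \<in> cball 0 1" for z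
    using one_minus_nonzero(1)[OF h(2)[OF that] assms(2)] .
  have "(\<lambda>z. 1 / (1 - h z)) \<in> disc_algebra"
    using nz h(1) by (intro disc_algebra_divide) auto
  from mult[OF this h(3)] show ?thesis
    by (rule cong) (use nz in auto)
qed

text \<open>Modulo \<open>I\<close>, \<open>F\<close> inverts \<open>1 - Z\<close> and hence
  \<open>1 - h\<close>, so \<open>F - 1\<close> is congruent to \<open>h / (1 - h)\<close>.\<close>

lemma small_inverse:
  assumes F: "F \<in> disc_algebra" and inv: "(\<lambda>z. (1 - Z z) * F z - 1) \<in> I"
    and Z: "small c Z" "c < 1"
  shows "small (c / (1 - c)) (\<lambda>z. F z - 1)"
proof -
  obtain h where h: "h \<in> disc_algebra" "\<And>z. z \<in> cball 0 1 \<Longrightarrow> cmod (h z) \<le> c" "(\<lambda>z. Z z - h z) \<in> I"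
    using Z(1) by (rule smallE) blast
  have nz: "1 - h z \<noteq> 0" if "z \<in> cball 0 1" for z
    using one_minus_nonzero(1)[OF h(2)[OF that] Z(2)] .
  show ?thesis
  proof (rule smallI)
    show "(\<lambda>z. h z / (1 - h z)) \<in> disc_algebra"
      using nz h(1) by (intro disc_algebra_divide) auto
    show "cmod (h z / (1 - h z)) \<le> c / (1 - c)" if "z \<in> cball 0 1" for z
      using norm_divide_one_minus(1)[OF h(2)[OF that] Z(2)] .
    show "(\<lambda>z. F z - 1 - h z / (1 - h z)) \<in> I"
    proof (rule comb[OF inv h(3)])
      show "(\<lambda>z. 1 / (1 - h z)) \<in> disc_algebra" "(\<lambda>z. F z / (1 - h z)) \<in> disc_algebra"
        using nz h(1) F by (auto intro!: disc_algebra_divide)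
      show "F z - 1 - h z / (1 - h z) = 1 / (1 - h z) * ((1 - Z z) * F z - 1) + F z / (1 - h z) * (Z z - h z)"
        if "z \<in> cball 0 1" for z
        using nz[OF that] by (simp add: divide_simps) (simp add: algebra_simps)
    qed
  qed
qed

text \<open>Now \<open>F\<close> is congruent to \<open>1 + h\<close>, so \<open>Z\<close> is
  congruent to \<open>1 - 1 / (1 + h) = h / (1 + h)\<close>.\<close>

lemma small_inverse_converse:
  assumes Zm: "Z \<in> disc_algebra" and inv: "(\<lambda>z. (1 - Z z) * F z - 1) \<in> I"
    and F: "small c (\<lambda>z. F z - 1)" "c < 1"
  shows "small (c / (1 - c)) Z"
proof -
  obtain h where h: "h \<in> disc_algebra" "\<And>z. z \<in> cball 0 1 \<Longrightarrow> cmod (h z) \<le> c" "(\<lambda>z. F z - 1 - h z) \<in> I"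
    using F(1) by (rule smallE) blast
  have nz: "1 + h z \<noteq> 0" if "z \<in> cball 0 1" for z
    using one_minus_nonzero(2)[OF h(2)[OF that] F(2)] .
  show ?thesis
  proof (rule smallI)
    show "(\<lambda>z. h z / (1 + h z)) \<in> disc_algebra"
      using nz h(1) by (intro disc_algebra_divide) auto
    show "cmod (h z / (1 + h z)) \<le> c / (1 - c)" if "z \<in> cball 0 1" for z
      using norm_divide_one_minus(2)[OF h(2)[OF that] F(2)] .
    show "(\<lambda>z. Z z - h z / (1 + h z)) \<in> I"
    proof (rule comb[OF inv h(3)])
      show "(\<lambda>z. -1 / (1 + h z)) \<in> disc_algebra" "(\<lambda>z. (1 - Z z) / (1 + h z)) \<in> disc_algebra"
        using nz h(1) Zm by (intro disc_algebra_intros; simp)+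
      show "Z z - h z / (1 + h z) = -1 / (1 + h z) * ((1 - Z z) * F z - 1) + (1 - Z z) / (1 + h z) * (F z - 1 - h z)"
        if "z \<in> cball 0 1" for z
        using nz[OF that] by (simp add: divide_simps) (simp add: algebra_simps)
    qed
  qed
qed

text \<open>Modulo \<open>I\<close>, \<open>(\<mu> - z) R\<close> is congruent to
  \<open>1 + (\<mu> - \<nu>) R\<close>, whose second term has modulus at most 1/2. Dividing
  \<open>R\<close> by this unit gives a resolvent at \<open>\<mu>\<close> at the cost of a factor
  2.\<close>

lemma resolvent_locally_bounded:
  assumes R: "R \<in> disc_algebra" "(\<lambda>z. (\<nu> - z) * R z - 1) \<in> I"
    and B: "B > 0" "\<And>z. z \<in> cball 0 1 \<Longrightarrow> cmod (R z) \<le> B" and \<mu>: "cmod (\<mu> - \<nu>) < 1 / (2 * B)"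
  shows "\<exists>S\<in>disc_algebra. (\<forall>z\<in>cball 0 1. cmod (S z) \<le> 2 * B) \<and> (\<lambda>z. (\<mu> - z) * S z - 1) \<in> I"
proof -
  define w where "w = (\<lambda>z. (\<mu> - \<nu>) * R z)"
  have w: "cmod (w z) \<le> 1/2" if "z \<in> cball 0 1" for z
  proof -
    have "cmod (w z) \<le> 1 / (2 * B) * B"
      unfolding w_def norm_mult using \<mu> B(1) B(2)[OF that] by (intro mult_mono) auto
    then show ?thesis using B(1) by simp
  qed
  have nz: "1 + w z \<noteq> 0" if "z \<in> cball 0 1" for z
    using one_minus_nonzero(2)[OF w[OF that]] by simp
  have wA: "w \<in> disc_algebra"
    unfolding w_def using R(1) by auto
  have inv: "(\<lambda>z. 1 / (1 + w z)) \<in> disc_algebra"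
    using nz wA by (intro disc_algebra_divide) auto
  show ?thesis
  proof (intro bexI[of _ "\<lambda>z. R z / (1 + w z)"] conjI ballI)
    show "(\<lambda>z. R z / (1 + w z)) \<in> disc_algebra"
      using nz wA R(1) by (intro disc_algebra_divide) auto
    show "cmod (R z / (1 + w z)) \<le> 2 * B" if "z \<in> cball 0 1" for z
    proof -
      have "1/2 \<le> cmod (1 + w z)"
        using w[OF that] norm_triangle_ineq2[of 1 "- w z"] by auto
      then have "cmod (R z / (1 + w z)) \<le> B / (1/2)"
        unfolding norm_divide using B(1) B(2)[OF that] by (intro frac_le) auto
      then show ?thesis by simp
    qed
    show "(\<lambda>z. (\<mu> - z) * (R z / (1 + w z)) - 1) \<in> I"
      by (rule cong[OF mult[OF inv R(2)]])
        (use nz in \<open>auto simp: divide_simps w_def algebra_simps\<close>)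
  qed
qed

text \<open>Compactness makes the local bounds uniform. The \<open>R \<nu>\<close> are chosen
  pointwise; continuity in \<open>\<nu>\<close> modulo \<open>I\<close> is recovered by
  \<open>resolvent_lipschitz\<close>.\<close>

lemma resolvent_bounded:
  assumes res: "\<And>\<nu>. \<exists>R\<in>disc_algebra. (\<lambda>z. (\<nu> - z) * R z - 1) \<in> I" and "compact K"
  obtains M R where "M > 0" "\<And>\<nu>. \<nu> \<in> K \<Longrightarrow> R \<nu> \<in> disc_algebra"
    "\<And>\<nu>. \<nu> \<in> K \<Longrightarrow> (\<lambda>z. (\<nu> - z) * R \<nu> z - 1) \<in> I"
    "\<And>\<nu> z. \<nu> \<in> K \<Longrightarrow> z \<in> cball 0 1 \<Longrightarrow> cmod (R \<nu> z) \<le> M"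
proof -
  have ex: "\<exists>B>0. \<forall>\<mu>. cmod (\<mu> - \<nu>) < 1 / (2 * B) \<longrightarrow>
      (\<exists>S\<in>disc_algebra. (\<forall>z\<in>cball 0 1. cmod (S z) \<le> 2 * B) \<and> (\<lambda>z. (\<mu> - z) * S z - 1) \<in> I)" for \<nu>
  proof -
    obtain R where R: "R \<in> disc_algebra" "(\<lambda>z. (\<nu> - z) * R z - 1) \<in> I"
      using res by blast
    obtain B where B: "B > 0" "\<And>z. z \<in> cball 0 1 \<Longrightarrow> cmod (R z) \<le> B"
      using disc_algebra_bounded[OF R(1)] by blast
    show ?thesis
      using resolvent_locally_bounded[OF R B] B(1) by blast
  qed
  obtain B where "\<forall>\<nu>. B \<nu> > 0 \<and> (\<forall>\<mu>. cmod (\<mu> - \<nu>) < 1 / (2 * B \<nu>) \<longrightarrow>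
      (\<exists>S\<in>disc_algebra. (\<forall>z\<in>cball 0 1. cmod (S z) \<le> 2 * B \<nu>) \<and> (\<lambda>z. (\<mu> - z) * S z - 1) \<in> I))"
    using choice[OF allI[OF ex]] ..
  then have B: "B \<nu> > 0" "cmod (\<mu> - \<nu>) < 1 / (2 * B \<nu>) \<Longrightarrow>
      (\<exists>S\<in>disc_algebra. (\<forall>z\<in>cball 0 1. cmod (S z) \<le> 2 * B \<nu>) \<and> (\<lambda>z. (\<mu> - z) * S z - 1) \<in> I)" for \<nu> \<mu>
    by blast+
  have "K \<subseteq> (\<Union>\<nu>\<in>K. ball \<nu> (1 / (2 * B \<nu>)))"
    using B(1) by auto
  then obtain L where L: "L \<subseteq> K" "finite L" "K \<subseteq> (\<Union>\<nu>\<in>L. ball \<nu> (1 / (2 * B \<nu>)))"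
    using compactE_image[OF \<open>compact K\<close>, of K "\<lambda>\<nu>. ball \<nu> (1 / (2 * B \<nu>))"] by auto
  define M where "M = 1 + (\<Sum>\<nu>\<in>L. 2 * B \<nu>)"
  have "M > 0"
    unfolding M_def by (intro add_pos_nonneg sum_nonneg zero_less_one mult_nonneg_nonneg less_imp_le[OF B(1)]) simp
  have "\<forall>\<mu>\<in>K. \<exists>S\<in>disc_algebra. (\<forall>z\<in>cball 0 1. cmod (S z) \<le> M) \<and> (\<lambda>z. (\<mu> - z) * S z - 1) \<in> I"
  proof
    fix \<mu> assume "\<mu> \<in> K"
    then obtain \<nu> where \<nu>: "\<nu> \<in> L" "cmod (\<mu> - \<nu>) < 1 / (2 * B \<nu>)"
      using L(3) by (auto simp: dist_norm norm_minus_commute)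
    have "2 * B \<nu> \<le> (\<Sum>\<nu>\<in>L. 2 * B \<nu>)"
      by (intro member_le_sum \<nu>(1) L(2) mult_nonneg_nonneg less_imp_le[OF B(1)]) simp
    then have "2 * B \<nu> \<le> M" unfolding M_def by simp
    then show "\<exists>S\<in>disc_algebra. (\<forall>z\<in>cball 0 1. cmod (S z) \<le> M) \<and> (\<lambda>z. (\<mu> - z) * S z - 1) \<in> I"
      using B(2)[OF \<nu>(2)] by (meson order_trans)
  qed
  then have "\<forall>\<mu>\<in>K. \<exists>S. S \<in> disc_algebra \<and> (\<forall>z\<in>cball 0 1. cmod (S z) \<le> M) \<and> (\<lambda>z. (\<mu> - z) * S z - 1) \<in> I"
    by blast
  from bchoice[OF this] obtain R where R: "\<forall>\<mu>\<in>K. R \<mu> \<in> disc_algebra \<and>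
      (\<forall>z\<in>cball 0 1. cmod (R \<mu> z) \<le> M) \<and> (\<lambda>z. (\<mu> - z) * R \<mu> z - 1) \<in> I" ..
  show thesis
    by (rule that[OF \<open>M > 0\<close>, of R]) (use R in auto)
qed

text \<open>The resolvent identity: \<open>\<nu> R - \<mu> S\<close> is congruent to
  \<open>z (\<mu> - \<nu>) R S\<close> modulo \<open>I\<close>.\<close>

lemma resolvent_lipschitz:
  assumes R: "R \<in> disc_algebra" "(\<lambda>z. (\<nu> - z) * R z - 1) \<in> I" "\<And>z. z \<in> cball 0 1 \<Longrightarrow> cmod (R z) \<le> M"
    and S: "S \<in> disc_algebra" "(\<lambda>z. (\<mu> - z) * S z - 1) \<in> I" "\<And>z. z \<in> cball 0 1 \<Longrightarrow> cmod (S z) \<le> M"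
    and "M > 0"
  shows "small (M\<^sup>2 * cmod (\<nu> - \<mu>)) (\<lambda>z. \<nu> * R z - \<mu> * S z)"
proof (rule smallI)
  show "(\<lambda>z. z * (\<mu> - \<nu>) * R z * S z) \<in> disc_algebra"
    by (intro disc_algebra_intros R S)
  show "cmod (z * (\<mu> - \<nu>) * R z * S z) \<le> M\<^sup>2 * cmod (\<nu> - \<mu>)" if z: "z \<in> cball 0 1" for z
  proof -
    have "cmod z * (cmod (R z) * cmod (S z)) \<le> 1 * (M * M)"
      using z R(3)[OF z] S(3)[OF z] \<open>M > 0\<close> by (intro mult_mono) auto
    then have "cmod (\<nu> - \<mu>) * (cmod z * (cmod (R z) * cmod (S z))) \<le> cmod (\<nu> - \<mu>) * (1 * (M * M))"
      by (rule mult_left_mono) simp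
    then show ?thesis
      by (simp add: norm_mult power2_eq_square norm_minus_commute mult_ac)
  qed
  show "(\<lambda>z. \<nu> * R z - \<mu> * S z - z * (\<mu> - \<nu>) * R z * S z) \<in> I"
  proof (rule comb[OF R(2) S(2)])
    show "(\<lambda>z. 1 + z * S z) \<in> disc_algebra" "(\<lambda>z. - 1 - z * R z) \<in> disc_algebra"
      by (intro disc_algebra_intros R S)+
  qed (simp add: algebra_simps)
qed

end

section \<open>Averages over roots of unity and the Gelfand-Mazur argument\<close>

lemma sum_powers_roots_unity:
  assumes "0 < k" "k \<le> n"
  shows "(\<Sum>j<n. cis (2 * pi * real j / real n) ^ k) = (if k = n then of_nat n else 0)"
proof -
  \<comment> \<open>The summand equals \<open>w ^ j\<close>, so the sum is geometric; for
    \<open>0 < k \<le> n\<close> the ratio is 1 only if \<open>k = n\<close>.\<close>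
  define w where "w = cis (2 * pi * real k / real n)"
  have pow: "cis (2 * pi * real j / real n) ^ k = w ^ j" for j
    unfolding w_def Complex.DeMoivre by (simp add: mult_ac)
  have "w = exp (2 * of_real pi * \<i> * of_nat k / of_nat n)"
    unfolding w_def cis_conv_exp by (simp add: mult_ac)
  then have w1: "w = 1 \<longleftrightarrow> k = n"
    using complex_root_unity_eq_1[of n k] assms by (auto dest: dvd_imp_le)
  have "w ^ n = cis (2 * pi * real k)"
    unfolding w_def Complex.DeMoivre using assms by simp
  then have wn: "w ^ n = 1"
    by simp
  show ?thesis
    unfolding pow using w1 wn by (cases "k = n") (auto simp: geometric_sum)
qed

text \<open>The partial fraction decomposition of \<open>n r\<^sup>n / (r\<^sup>n - z\<^sup>n)\<close> with denominators cleared.\<close>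

lemma sum_resolvents_roots_unity:
  fixes z :: complex and r :: real
  assumes "n > 0"
  defines "p \<equiv> \<lambda>j. of_real r * cis (2 * pi * real j / real n)"
  shows "(\<Sum>j<n. p j * (\<Sum>i<n. z ^ (n - Suc i) * p j ^ i)) = of_nat n * of_real r ^ n"
proof -
  have "(\<Sum>j<n. p j * (\<Sum>i<n. z ^ (n - Suc i) * p j ^ i)) = (\<Sum>j<n. \<Sum>i<n. z ^ (n - Suc i) * p j ^ Suc i)"
    by (simp add: sum_distrib_left mult_ac)
  also have "\<dots> = (\<Sum>i<n. \<Sum>j<n. z ^ (n - Suc i) * p j ^ Suc i)"
    by (rule sum.swap)
  also have "\<dots> = (\<Sum>i<n. z ^ (n - Suc i) * of_real r ^ Suc i * (\<Sum>j<n. cis (2 * pi * real j / real n) ^ Suc i))"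
    by (simp only: p_def power_mult_distrib sum_distrib_left mult.assoc)
  \<comment> \<open>The exponent \<open>Suc i\<close> runs from 1 to \<open>n\<close>, so only
    \<open>i = n - 1\<close> contributes.\<close>
  also have "\<dots> = (\<Sum>i<n. if i = n - 1 then of_nat n * of_real r ^ n else 0)"
    using assms(1) by (intro sum.cong refl) (subst sum_powers_roots_unity, auto)
  also have "\<dots> = of_nat n * of_real r ^ n"
    using assms(1) by simp
  finally show ?thesis .
qed

context disc_ideal
begin

text \<open>The hypothesis says that the class of \<open>z\<close> modulo \<open>I\<close> has empty
  spectrum, which forces the quotient to be zero.\<close>

theorem one_mem_if_empty_spectrum:
  assumes res: "\<And>\<nu>. \<exists>R\<in>disc_algebra. (\<lambda>z. (\<nu> - z) * R z - 1) \<in> I"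
  shows "(\<lambda>_. 1) \<in> I"
proof -
  \<comment> \<open>Radius 2 gives the starting point: on the closed disc \<open>z / 2\<close> has
    modulus at most 1/2.\<close>
  obtain M R where M: "M > 0" and RA: "\<And>\<nu>. \<nu> \<in> cball 0 2 \<Longrightarrow> R \<nu> \<in> disc_algebra"
    and RI: "\<And>\<nu>. \<nu> \<in> cball 0 2 \<Longrightarrow> (\<lambda>z. (\<nu> - z) * R \<nu> z - 1) \<in> I"
    and RM: "\<And>\<nu> z. \<nu> \<in> cball 0 2 \<Longrightarrow> z \<in> cball 0 1 \<Longrightarrow> cmod (R \<nu> z) \<le> M"
    using resolvent_bounded[OF res compact_cball[of 0 2]] by blast
  define p where "p = (\<lambda>n r j. complex_of_real r * cis (2 * pi * real j / real n))"
  define F where "F = (\<lambda>n r z. (1 / of_nat n) * (\<Sum>j<n. p n r j * R (p n r j) z))"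
  have p_mem: "p n r j \<in> cball 0 2" if "0 \<le> r" "r \<le> 2" for n r j
    using that by (simp add: p_def norm_mult)
  have FA: "F n r \<in> disc_algebra" if "0 \<le> r" "r \<le> 2" for n r
    unfolding F_def by (intro disc_algebra_intros RA p_mem that)
  \<comment> \<open>Modulo \<open>I\<close>, the average \<open>F n r\<close> inverts
    \<open>1 - (z / r) ^ n\<close>, by partial fractions.\<close>
  have F_res: "(\<lambda>z. (1 - (z / of_real r) ^ n) * F n r z - 1) \<in> I" if r: "0 < r" "r \<le> 2" and n: "n > 0" for n r
  proof -
    \<comment> \<open>\<open>q j\<close> is the polynomial quotient of \<open>r ^ n - z ^ n\<close>
      by \<open>p n r j - z\<close>, so the sum below clears all denominators; \<open>c\<close>
      normalises it.\<close>
    define q where "q = (\<lambda>j z. (\<Sum>i<n. z ^ (n - Suc i) * p n r j ^ i))"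
    define c where "c = 1 / (of_nat n * complex_of_real r ^ n)"
    have "(\<lambda>z. \<Sum>j<n. p n r j * q j z * ((p n r j - z) * R (p n r j) z - 1)) \<in> I"
    proof (rule sum_mem)
      show "(\<lambda>z. p n r j * q j z * ((p n r j - z) * R (p n r j) z - 1)) \<in> I" for j
        by (rule mult) (use r in \<open>auto simp: q_def intro!: disc_algebra_intros RI p_mem\<close>)
    qed simp
    from mult[OF disc_algebra_const this, of c] show ?thesis
    proof (rule cong)
      fix z :: complex
      have pn: "p n r j ^ n = of_real r ^ n" for j
        unfolding p_def power_mult_distrib Complex.DeMoivre using n by simp
      have *: "q j z * (p n r j - z) = of_real r ^ n - z ^ n" for j
        using power_diff_sumr2[of "p n r j" n z] by (simp add: q_def pn mult.commute)
      have "p n r j * q j z * ((p n r j - z) * R (p n r j) z - 1) =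
          (of_real r ^ n - z ^ n) * (p n r j * R (p n r j) z) - p n r j * q j z" for j
        unfolding *[of j, symmetric] by (simp add: algebra_simps)
      then have "(\<Sum>j<n. p n r j * q j z * ((p n r j - z) * R (p n r j) z - 1)) =
          (of_real r ^ n - z ^ n) * (\<Sum>j<n. p n r j * R (p n r j) z) - (\<Sum>j<n. p n r j * q j z)"
        by (simp add: sum_subtractf sum_distrib_left)
      also have "(\<Sum>j<n. p n r j * q j z) = of_nat n * of_real r ^ n"
        unfolding q_def p_def by (rule sum_resolvents_roots_unity[OF n])
      also have "(\<Sum>j<n. p n r j * R (p n r j) z) = of_nat n * F n r z"
        using n by (simp add: F_def)
      finally have eq: "(\<Sum>j<n. p n r j * q j z * ((p n r j - z) * R (p n r j) z - 1)) =
          (of_real r ^ n - z ^ n) * (of_nat n * F n r z) - of_nat n * of_real r ^ n" .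
      have "of_nat n \<noteq> (0::complex)" "complex_of_real r ^ n \<noteq> 0"
        using n r by auto
      then show "(1 - (z / of_real r) ^ n) * F n r z - 1 =
          c * (\<Sum>j<n. p n r j * q j z * ((p n r j - z) * R (p n r j) z - 1))"
        unfolding eq c_def power_divide by (simp add: field_simps)
    qed
  qed
  \<comment> \<open>Corresponding nodes lie on one ray at distance \<open>\<bar>r - s\<bar>\<close>,
    so the bound does not depend on \<open>n\<close>.\<close>
  have F_lip: "small (M\<^sup>2 * \<bar>r - s\<bar>) (\<lambda>z. F n r z - F n s z)"
    if "0 \<le> r" "r \<le> 2" "0 \<le> s" "s \<le> 2" "n > 0" for n r s
  proof -
    have pp: "cmod (p n r j - p n s j) = \<bar>r - s\<bar>" for j
      by (simp add: p_def norm_mult flip: left_diff_distrib of_real_diff)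
    have "small (\<Sum>j<n. M\<^sup>2 * \<bar>r - s\<bar>) (\<lambda>z. \<Sum>j<n. p n r j * R (p n r j) z - p n s j * R (p n s j) z)"
    proof (rule small_sum)
      show "small (M\<^sup>2 * \<bar>r - s\<bar>) (\<lambda>z. p n r j * R (p n r j) z - p n s j * R (p n s j) z)" for j
        using that(1-4) unfolding pp[of j, symmetric]
        by (intro resolvent_lipschitz RA RI RM M p_mem)
    qed simp
    then have "small (1 / real n * (\<Sum>j<n. M\<^sup>2 * \<bar>r - s\<bar>))
        (\<lambda>z. (1 / of_nat n) * (\<Sum>j<n. p n r j * R (p n r j) z - p n s j * R (p n s j) z))"
      by (intro small_mult[OF small_bound[OF disc_algebra_const]] disc_algebra_const)
        (auto simp: norm_divide)
    then have "small (M\<^sup>2 * \<bar>r - s\<bar>)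
        (\<lambda>z. (1 / of_nat n) * (\<Sum>j<n. p n r j * R (p n r j) z - p n s j * R (p n s j) z))"
      using \<open>n > 0\<close> by simp
    then show ?thesis
      by (rule small_cong) (simp add: F_def sum_subtractf diff_divide_distrib)
  qed
  \<comment> \<open>The exponent may depend on \<open>r\<close>; the uniformity in \<open>n\<close>
    of \<open>F_lip\<close> is what makes this harmless.\<close>
  define P where "P = (\<lambda>r. \<exists>n>0. small (1/2) (\<lambda>z. (z / complex_of_real r) ^ n))"
  have F_one: "\<exists>n>0. small (1/7) (\<lambda>z. F n r z - 1)" if P: "P r" and r: "0 < r" "r \<le> 2" for r
  proof -
    obtain n where n: "n > 0" "small (1/2) (\<lambda>z. (z / complex_of_real r) ^ n)"
      using P unfolding P_def by blast
    have zr: "(\<lambda>z. (z / complex_of_real r) ^ n) \<in> disc_algebra"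
      using r by (intro disc_algebra_intros) auto
    \<comment> \<open>Cubing improves 1/2 to 1/8, and
      \<open>(1/8) / (1 - 1/8) = 1/7\<close>.\<close>
    have "small (1/8) (\<lambda>z. (z / complex_of_real r) ^ (n * 3))"
      using small_power[OF n(2) zr, of 3] by (simp add: power_mult power3_eq_cube)
    then have "small (1/7) (\<lambda>z. F (n * 3) r z - 1)"
      using small_inverse[OF FA F_res, of r "n * 3" "1/8"] n(1) r by simp
    then show ?thesis
      using n(1) by (intro exI[of _ "n * 3"]) auto
  qed
  \<comment> \<open>The step length is chosen so that moving by \<open>d\<close> costs at most 1/7.
    Then \<open>F n s - 1\<close> is bounded by 2/7, and \<open>(2/7) / (1 - 2/7) = 2/5\<close> is
    again below 1/2, so \<open>P\<close> propagates with a fixed step.\<close>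
  define d where "d = 1 / (7 * M\<^sup>2)"
  have d: "d > 0"
    using M by (simp add: d_def)
  \<comment> \<open>\<open>s = 0\<close> is allowed here, unlike in \<open>P_step\<close>, where
    \<open>z / s\<close> appears.\<close>
  have F_near: "\<exists>n>0. small (2/7) (\<lambda>z. F n s z - 1)"
    if P: "P r" and r: "0 < r" "r \<le> 2" and s: "0 \<le> s" "s \<le> 2" "\<bar>s - r\<bar> \<le> d" for r s
  proof -
    obtain n where n: "n > 0" "small (1/7) (\<lambda>z. F n r z - 1)"
      using F_one[OF P r] by blast
    have "M\<^sup>2 * \<bar>s - r\<bar> \<le> M\<^sup>2 * d"
      using s(3) by (intro mult_left_mono) auto
    also have "\<dots> = 1/7"
      using M by (simp add: d_def)
    finally have "small (1/7) (\<lambda>z. F n s z - F n r z)"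
      using F_lip[of s r n] s r n by (auto intro: small_mono)
    from small_add[OF this n(2)] show ?thesis
      using n(1) by auto
  qed
  have P_step: "P s" if "P r" "0 < r" "r \<le> 2" "0 < s" "s \<le> 2" "\<bar>s - r\<bar> \<le> d" for r s
  proof -
    have "\<exists>n>0. small (2/7) (\<lambda>z. F n s z - 1)"
      using that by (intro F_near[of r s]) auto
    then obtain n where n: "n > 0" "small (2/7) (\<lambda>z. F n s z - 1)"
      by blast
    have zs: "(\<lambda>z. (z / complex_of_real s) ^ n) \<in> disc_algebra"
      using that by (intro disc_algebra_intros) auto
    have "small ((2/7) / (1 - 2/7)) (\<lambda>z. (z / complex_of_real s) ^ n)"
      by (rule small_inverse_converse[OF zs F_res n(2)]) (use that n in auto)
    then have "small (1/2) (\<lambda>z. (z / complex_of_real s) ^ n)"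
      by (rule small_mono) simp
    then show ?thesis
      using n(1) unfolding P_def by blast
  qed
  have P2: "P 2"
    unfolding P_def by (intro exI[of _ 1] conjI small_bound disc_algebra_intros) (auto simp: norm_divide)
  have P_all: "P r" if "0 < r" "r \<le> 2" "2 - r \<le> real k * d" for k r
    using that
  proof (induction k arbitrary: r)
    case 0
    then show ?case using P2 by simp
  next
    case (Suc k)
    define s where "s = min 2 (r + d)"
    have "P s"
      using Suc.prems d by (intro Suc.IH) (auto simp: s_def min_def algebra_simps)
    then show ?case
      using Suc.prems d by (intro P_step[of s r]) (auto simp: s_def min_def)
  qed
  \<comment> \<open>A radius that is still positive but within one step of 0.\<close>
  define r where "r = min 1 d"
  obtain k where k: "2 < real k * d"
    using reals_Archimedean3[OF d] by blast
  have "P r"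
    by (rule P_all[of r k]) (use d k in \<open>auto simp: r_def\<close>)
  then obtain n where n: "n > 0" "small (2/7) (\<lambda>z. F n 0 z - 1)"
    using F_near[of r 0] d by (auto simp: r_def min_def split: if_splits)
  \<comment> \<open>All nodes \<open>p n 0 j\<close> vanish, so \<open>F n 0 = 0\<close> and
    \<open>-1\<close> itself is small.\<close>
  have m1: "small (2/7) (\<lambda>_. -1)"
    using n(2) by (rule small_cong) (simp add: F_def p_def)
  have "small (1 * (2/7)) (\<lambda>_. (-1) * (-1))"
    by (intro small_mult[OF small_bound[OF disc_algebra_const] m1 disc_algebra_const]) simp
  then show ?thesis
    by (intro one_mem_if_small[of "2/7"]) auto
qed

end

section \<open>The corona theorem\<close>

text \<open>By uniform continuity on the closed disc. The dilate is holomorphic on a larger disc,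
  which makes difference quotients and power series available up to the boundary.\<close>

lemma disc_algebra_dilation_approx:
  assumes f: "f \<in> disc_algebra" and "e > 0"
  obtains r :: real where "0 < r" "r < 1" "\<And>z. z \<in> cball 0 1 \<Longrightarrow> cmod (f (of_real r * z) - f z) < e"
proof -
  have "uniformly_continuous_on (cball 0 1) f"
    using f by (intro compact_uniformly_continuous) (auto simp: disc_algebra_def)
  then obtain d where d: "d > 0" "\<And>x y. x \<in> cball 0 1 \<Longrightarrow> y \<in> cball 0 1 \<Longrightarrow> dist y x < d \<Longrightarrow> dist (f y) (f x) < e"
    using \<open>e > 0\<close> unfolding uniformly_continuous_on_def by metis
  define r where "r = max (1/2) (1 - d/2)"
  have r: "0 < r" "r < 1" "1 - r < d"
    using d(1) by (auto simp: r_def max_def)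
  show thesis
  proof (rule that[OF r(1,2)])
    fix z :: complex assume z: "z \<in> cball 0 1"
    have "cmod (of_real r * z) \<le> 1 * 1"
      unfolding norm_mult using z r by (intro mult_mono) auto
    then have 1: "of_real r * z \<in> cball 0 1" by simp
    have "dist (of_real r * z) z = cmod (of_real (r - 1) * z)"
      by (simp add: dist_norm algebra_simps)
    also have "\<dots> = (1 - r) * cmod z"
      using r by (simp add: norm_mult del: of_real_diff)
    also have "\<dots> \<le> (1 - r) * 1"
      using z r by (intro mult_left_mono) auto
    finally have "dist (of_real r * z) z < d"
      using r by simp
    from d(2)[OF z 1 this] show "cmod (f (of_real r * z) - f z) < e"
      by (simp add: dist_norm)
  qed
qed

lemma holomorphic_on_dilation:
  assumes f: "f \<in> disc_algebra" and r: "0 < r"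
  shows "(\<lambda>z. f (of_real r * z)) holomorphic_on ball 0 (1 / r)"
proof -
  have "f \<circ> (\<lambda>z. of_real r * z) holomorphic_on ball 0 (1 / r)"
  proof (rule holomorphic_on_compose_gen)
    show "f holomorphic_on ball 0 1" using f by (simp add: disc_algebra_def)
    show "(\<lambda>z::complex. of_real r * z) ` ball 0 (1 / r) \<subseteq> ball 0 1"
    proof
      fix w :: complex assume "w \<in> (\<lambda>z. of_real r * z) ` ball 0 (1 / r)"
      then obtain z :: complex where "w = of_real r * z" "z \<in> ball 0 (1 / r)"
        by (rule imageE)
      then have "cmod z < 1 / r" by (simp only: mem_ball_0)
      with \<open>w = of_real r * z\<close> show "w \<in> ball 0 1"
        using r by (simp add: norm_mult field_simps)
    qed
  qed (auto intro: holomorphic_intros)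
  then show ?thesis by (simp add: o_def)
qed

text \<open>If \<open>a\<close> lies on the circle, the difference quotient of \<open>f\<close> at
  \<open>a\<close> may leave the algebra, so it is formed for a dilate \<open>F\<close>. The error
  is absorbed in \<open>w = f - F + F a\<close>, which stays close to \<open>f a\<close> and is
  therefore a unit; then \<open>(a - z) h = w - f\<close>, and dividing by \<open>w\<close> gives
  the claim.\<close>

lemma resolvent_mod:
  assumes f: "f \<in> disc_algebra" and a: "a \<in> cball 0 1" "f a \<noteq> 0"
  shows "\<exists>R\<in>disc_algebra. \<exists>w\<in>disc_algebra. \<forall>z\<in>cball 0 1. (a - z) * R z - 1 = w z * f z"
proof -
  define c where "c = cmod (f a)"
  have c: "c > 0" using a by (simp add: c_def)
  obtain r where r: "0 < r" "r < 1" "\<And>z. z \<in> cball 0 1 \<Longrightarrow> cmod (f (of_real r * z) - f z) < c / 4"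
    using disc_algebra_dilation_approx[OF f, of "c/4"] c by auto
  define F where "F = (\<lambda>z. f (of_real r * z))"
  \<comment> \<open>The value at \<open>a\<close> removes the singularity.\<close>
  define h where "h = (\<lambda>z. if z = a then deriv F a else (F z - F a) / (z - a))"
  define w where "w = (\<lambda>z. f z - F z + F a)"
  have sub: "cball (0::complex) 1 \<subseteq> ball 0 (1 / r)"
  proof
    fix z :: complex assume "z \<in> cball 0 1"
    moreover have "1 < 1 / r" using r by simp
    ultimately have "cmod z < 1 / r"
      by (metis mem_cball_0 le_less_trans)
    then show "z \<in> ball 0 (1 / r)" by (simp only: mem_ball_0)
  qed
  have Fhol: "F holomorphic_on ball 0 (1 / r)"
    unfolding F_def by (rule holomorphic_on_dilation[OF f r(1)])
  have hA: "h \<in> disc_algebra"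
    unfolding h_def by (rule holomorphic_imp_disc_algebra[OF pole_lemma_open[OF Fhol open_ball] sub])
  have FA: "F \<in> disc_algebra"
    by (rule holomorphic_imp_disc_algebra[OF Fhol sub])
  have wA: "w \<in> disc_algebra"
    unfolding w_def by (intro disc_algebra_intros f FA)
  have nz: "w z \<noteq> 0" if "z \<in> cball 0 1" for z
  proof
    assume "w z = 0"
    then have "f a = (F z - f z) - (F a - f a)" by (simp add: w_def algebra_simps)
    then have "c \<le> cmod (F z - f z) + cmod (F a - f a)"
      unfolding c_def by (metis norm_triangle_ineq4)
    then show False
      using r(3)[OF that] r(3)[OF a(1)] c by (simp add: F_def)
  qed
  have hw: "(z - a) * h z = F z - F a" for z
    by (simp add: h_def)
  have w: "(a - z) * (h z / w z) - 1 = - 1 / w z * f z" if "z \<in> cball 0 1" for z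
  proof -
    have "(a - z) * h z = w z - f z"
      using hw[of z] by (simp add: w_def algebra_simps)
    then have "(a - z) * (h z / w z) = (w z - f z) / w z" by simp
    then show ?thesis
      using nz[OF that] by (simp only: diff_divide_distrib) simp
  qed
  show ?thesis
    by (rule bexI[of _ "\<lambda>z. h z / w z"], rule bexI[of _ "\<lambda>z. - 1 / w z"])
      (use w nz hA wA in \<open>auto intro!: disc_algebra_divide disc_algebra_const simp del: minus_divide_left\<close>)
qed

text \<open>The generated ideal has empty spectrum: \<open>a - z\<close> is a unit for
  \<open>a\<close> outside the closed disc, and otherwise \<open>resolvent_mod\<close> inverts it
  modulo whichever of \<open>f\<close>, \<open>g\<close> is nonzero at \<open>a\<close>.\<close>

theorem disc_algebra_corona:
  assumes f: "f \<in> disc_algebra" and g: "g \<in> disc_algebra"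
    and nz: "\<And>z. z \<in> cball 0 1 \<Longrightarrow> f z \<noteq> 0 \<or> g z \<noteq> 0"
  obtains x y where "x \<in> disc_algebra" "y \<in> disc_algebra"
    "\<And>z. z \<in> cball 0 1 \<Longrightarrow> x z * f z + y z * g z = 1"
proof -
  define I where "I = {k. \<exists>x\<in>disc_algebra. \<exists>y\<in>disc_algebra. \<forall>z\<in>cball 0 1. k z = x z * f z + y z * g z}"
  have I: "k \<in> I" if "x \<in> disc_algebra" "y \<in> disc_algebra"
    "\<And>z. z \<in> cball 0 1 \<Longrightarrow> k z = x z * f z + y z * g z" for k x y
    unfolding I_def using that by blast
  have IE: "\<exists>x y. x \<in> disc_algebra \<and> y \<in> disc_algebra \<and> (\<forall>z\<in>cball 0 1. k z = x z * f z + y z * g z)"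
    if "k \<in> I" for k
    using that unfolding I_def by blast
  interpret disc_ideal I
  proof
    show "(\<lambda>_. 0) \<in> I"
      by (rule I[of "\<lambda>_. 0" "\<lambda>_. 0"]) auto
  next
    fix k l assume "k \<in> I" "l \<in> I"
    obtain x y where 1: "x \<in> disc_algebra" "y \<in> disc_algebra" "\<forall>z\<in>cball 0 1. k z = x z * f z + y z * g z"
      using IE[OF \<open>k \<in> I\<close>] by blast
    obtain u v where 2: "u \<in> disc_algebra" "v \<in> disc_algebra" "\<forall>z\<in>cball 0 1. l z = u z * f z + v z * g z"
      using IE[OF \<open>l \<in> I\<close>] by blast
    show "(\<lambda>z. k z + l z) \<in> I"
      by (rule I[OF disc_algebra_add[OF 1(1) 2(1)] disc_algebra_add[OF 1(2) 2(2)]])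
        (use 1 2 in \<open>simp add: algebra_simps\<close>)
  next
    fix a k assume a: "a \<in> disc_algebra" and "k \<in> I"
    obtain x y where 1: "x \<in> disc_algebra" "y \<in> disc_algebra" "\<forall>z\<in>cball 0 1. k z = x z * f z + y z * g z"
      using IE[OF \<open>k \<in> I\<close>] by blast
    show "(\<lambda>z. a z * k z) \<in> I"
      by (rule I[OF disc_algebra_mult[OF a 1(1)] disc_algebra_mult[OF a 1(2)]])
        (use 1 in \<open>simp add: algebra_simps\<close>)
  next
    fix k l assume "k \<in> I" and kl: "\<And>z. z \<in> cball 0 1 \<Longrightarrow> l z = k z"
    then show "l \<in> I"
      unfolding I_def by simp
  qed
  have "(\<lambda>_. 1) \<in> I"
  proof (rule one_mem_if_empty_spectrum)
    fix a :: complex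
    consider "cmod a > 1" | "a \<in> cball 0 1" "f a \<noteq> 0" | "a \<in> cball 0 1" "g a \<noteq> 0"
      using nz[of a] by fastforce
    then show "\<exists>R\<in>disc_algebra. (\<lambda>z. (a - z) * R z - 1) \<in> I"
    proof cases
      case 1
      then have "a - z \<noteq> 0" if "z \<in> cball 0 1" for z
        using that by auto
      then show ?thesis
        by (intro bexI[of _ "\<lambda>z. 1 / (a - z)"] cong[OF zero] disc_algebra_intros) auto
    next
      case 2
      from resolvent_mod[OF f 2] obtain R w where R: "R \<in> disc_algebra" "w \<in> disc_algebra"
        "\<forall>z\<in>cball 0 1. (a - z) * R z - 1 = w z * f z"
        by (elim bexE)
      have "(\<lambda>z. (a - z) * R z - 1) \<in> I"
        by (intro I[OF R(2) disc_algebra_const[of 0]]) (simp only: R(3)[rule_format] mult_zero_left add_0_right)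
      then show ?thesis using R(1) by blast
    next
      case 3
      from resolvent_mod[OF g 3] obtain R w where R: "R \<in> disc_algebra" "w \<in> disc_algebra"
        "\<forall>z\<in>cball 0 1. (a - z) * R z - 1 = w z * g z"
        by (elim bexE)
      have "(\<lambda>z. (a - z) * R z - 1) \<in> I"
        by (intro I[OF disc_algebra_const[of 0] R(2)]) (simp only: R(3)[rule_format] mult_zero_left add_0_left)
      then show ?thesis using R(1) by blast
    qed
  qed
  from IE[OF this] obtain x y where xy: "x \<in> disc_algebra" "y \<in> disc_algebra"
    "\<forall>z\<in>cball 0 1. 1 = x z * f z + y z * g z"
    by blast
  show thesis
    by (rule that[OF xy(1,2)]) (use xy(3) in metis)
qed

section \<open>The real-symmetric subalgebra and its corona theorem\<close>

lemma real_disc_algebra_imp_disc_algebra: "f \<in> real_disc_algebra \<Longrightarrow> f \<in> disc_algebra"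
  by (simp add: real_disc_algebra_def)

lemma real_disc_algebra_cnj:
  assumes "f \<in> real_disc_algebra" "z \<in> cball 0 1"
  shows "f (cnj z) = cnj (f z)"
proof -
  have "cnj z \<in> cball 0 1"
    using assms(2) by simp
  then have "f (cnj z) = cnj (f (cnj (cnj z)))"
    using assms(1) unfolding real_disc_algebra_def by blast
  then show ?thesis by simp
qed

lemma real_disc_algebraI:
  "f \<in> disc_algebra \<Longrightarrow> (\<And>z. z \<in> cball 0 1 \<Longrightarrow> f (cnj z) = cnj (f z)) \<Longrightarrow> f \<in> real_disc_algebra"
  by (simp add: real_disc_algebra_def)

lemma real_disc_algebra_const: "Im c = 0 \<Longrightarrow> (\<lambda>_. c) \<in> real_disc_algebra"
  by (intro real_disc_algebraI disc_algebra_intros) (simp add: complex_eq_iff)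

lemma real_disc_algebra_ident: "(\<lambda>z. z) \<in> real_disc_algebra"
  by (intro real_disc_algebraI disc_algebra_intros) simp

lemma real_disc_algebra_add:
  "f \<in> real_disc_algebra \<Longrightarrow> g \<in> real_disc_algebra \<Longrightarrow> (\<lambda>z. f z + g z) \<in> real_disc_algebra"
  by (intro real_disc_algebraI disc_algebra_intros)
    (auto simp: real_disc_algebra_cnj real_disc_algebra_imp_disc_algebra)

lemma real_disc_algebra_uminus:
  "f \<in> real_disc_algebra \<Longrightarrow> (\<lambda>z. - f z) \<in> real_disc_algebra"
  by (intro real_disc_algebraI disc_algebra_intros)
    (auto simp: real_disc_algebra_cnj real_disc_algebra_imp_disc_algebra)

lemma real_disc_algebra_diff:
  "f \<in> real_disc_algebra \<Longrightarrow> g \<in> real_disc_algebra \<Longrightarrow> (\<lambda>z. f z - g z) \<in> real_disc_algebra"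
  by (intro real_disc_algebraI disc_algebra_intros)
    (auto simp: real_disc_algebra_cnj real_disc_algebra_imp_disc_algebra)

lemma real_disc_algebra_mult:
  "f \<in> real_disc_algebra \<Longrightarrow> g \<in> real_disc_algebra \<Longrightarrow> (\<lambda>z. f z * g z) \<in> real_disc_algebra"
  by (intro real_disc_algebraI disc_algebra_intros)
    (auto simp: real_disc_algebra_cnj real_disc_algebra_imp_disc_algebra)

lemma real_disc_algebra_divide:
  "f \<in> real_disc_algebra \<Longrightarrow> g \<in> real_disc_algebra \<Longrightarrow> (\<And>z. z \<in> cball 0 1 \<Longrightarrow> g z \<noteq> 0)
    \<Longrightarrow> (\<lambda>z. f z / g z) \<in> real_disc_algebra"
  by (intro real_disc_algebraI disc_algebra_intros)
    (auto simp: real_disc_algebra_cnj real_disc_algebra_imp_disc_algebra)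

lemmas real_disc_algebra_intros = real_disc_algebra_const real_disc_algebra_ident real_disc_algebra_add
  real_disc_algebra_uminus real_disc_algebra_diff real_disc_algebra_mult real_disc_algebra_divide

lemma real_disc_algebra_real_value:
  assumes "f \<in> real_disc_algebra" "-1 \<le> t" "t \<le> 1"
  shows "f (complex_of_real t) = of_real (Re (f (of_real t)))"
proof -
  have "f (cnj (of_real t)) = cnj (f (of_real t))"
    using assms by (intro real_disc_algebra_cnj) auto
  then show ?thesis
    by (simp add: complex_eq_iff)
qed

lemma disc_algebra_reflect:
  assumes f: "f \<in> disc_algebra"
  shows "(\<lambda>z. cnj (f (cnj z))) \<in> disc_algebra"
proof -
  have cnj_image: "cnj ` S = S" if S: "\<And>z. z \<in> S \<Longrightarrow> cnj z \<in> S" for S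
  proof (intro equalityI subsetI)
    fix z assume "z \<in> S"
    then have "cnj (cnj z) \<in> cnj ` S"
      by (intro imageI S)
    then show "z \<in> cnj ` S" by simp
  qed (use S in blast)
  have img: "cnj ` ball 0 1 = ball 0 1" "cnj ` cball 0 1 = cball 0 1"
    by (rule cnj_image; simp)+
  have "cnj \<circ> f \<circ> cnj holomorphic_on ball 0 1"
    by (rule holomorphic_on_compose_cnj_cnj) (use f img in \<open>simp_all add: disc_algebra_def\<close>)
  moreover have "continuous_on (cball 0 1) (\<lambda>z. cnj (f (cnj z)))"
  proof (rule continuous_on_cnj, rule continuous_on_compose2[of "cball 0 1" f "cball 0 1" cnj])
    show "continuous_on (cball 0 1) f"
      using f by (simp add: disc_algebra_def)
    show "cnj ` cball 0 1 \<subseteq> cball 0 1"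
      unfolding img ..
  qed (rule bounded_linear.continuous_on[OF bounded_linear_cnj continuous_on_id])
  ultimately show ?thesis
    by (simp add: disc_algebra_def o_def)
qed

text \<open>The average over the involution whose fixed points are the real-symmetric
  functions.\<close>

definition real_part_symm :: "(complex \<Rightarrow> complex) \<Rightarrow> complex \<Rightarrow> complex" where
  "real_part_symm f z = (f z + cnj (f (cnj z))) / 2"

lemma real_part_symm_mem: "f \<in> disc_algebra \<Longrightarrow> real_part_symm f \<in> real_disc_algebra"
  unfolding real_part_symm_def[abs_def]
  by (intro real_disc_algebraI disc_algebra_intros disc_algebra_reflect) auto

text \<open>Reflecting a Bezout equation gives another one, since \<open>f\<close> and
  \<open>g\<close> are symmetric; the average of the two has symmetric coefficients.\<close>

theorem real_disc_algebra_corona: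
  assumes f: "f \<in> real_disc_algebra" and g: "g \<in> real_disc_algebra"
    and nz: "\<And>z. z \<in> cball 0 1 \<Longrightarrow> f z \<noteq> 0 \<or> g z \<noteq> 0"
  obtains x y where "x \<in> real_disc_algebra" "y \<in> real_disc_algebra"
    "\<And>z. z \<in> cball 0 1 \<Longrightarrow> x z * f z + y z * g z = 1"
proof -
  obtain x y where xy: "x \<in> disc_algebra" "y \<in> disc_algebra"
    "\<And>z. z \<in> cball 0 1 \<Longrightarrow> x z * f z + y z * g z = 1"
    using disc_algebra_corona[OF f[THEN real_disc_algebra_imp_disc_algebra]
        g[THEN real_disc_algebra_imp_disc_algebra] nz] by blast
  show thesis
  proof (rule that[OF real_part_symm_mem[OF xy(1)] real_part_symm_mem[OF xy(2)]])
    fix z :: complex assume z: "z \<in> cball 0 1"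
    then have "x (cnj z) * f (cnj z) + y (cnj z) * g (cnj z) = 1"
      by (intro xy) auto
    then have "x (cnj z) * cnj (f z) + y (cnj z) * cnj (g z) = 1"
      using z f g by (simp add: real_disc_algebra_cnj)
    then have "cnj (x (cnj z) * cnj (f z) + y (cnj z) * cnj (g z)) = cnj 1"
      by (rule arg_cong)
    then have "cnj (x (cnj z)) * f z + cnj (y (cnj z)) * g z = 1"
      by simp
    moreover have "real_part_symm x z * f z + real_part_symm y z * g z =
        ((x z * f z + y z * g z) + (cnj (x (cnj z)) * f z + cnj (y (cnj z)) * g z)) / 2"
      by (simp add: real_part_symm_def field_simps)
    ultimately show "real_part_symm x z * f z + real_part_symm y z * g z = 1"
      using xy(3)[OF z] by simp
  qed
qed

section \<open>Units modulo a function\<close>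

text \<open>The modulus comes first. For \<open>q = f1\<close> and \<open>g = f2\<close> this is the
  goal in disguise: \<open>g1 = 1 / u\<close> and \<open>g2 = - h / u\<close>.\<close>

definition unit_mod :: "(complex \<Rightarrow> complex) \<Rightarrow> (complex \<Rightarrow> complex) \<Rightarrow> bool" where
  "unit_mod g q \<longleftrightarrow> (\<exists>u\<in>real_disc_algebra. \<exists>h\<in>real_disc_algebra.
     (\<forall>z\<in>cball 0 1. u z \<noteq> 0) \<and> (\<forall>z\<in>cball 0 1. q z = u z + h z * g z))"

lemma unit_modI:
  "u \<in> real_disc_algebra \<Longrightarrow> h \<in> real_disc_algebra \<Longrightarrow> (\<And>z. z \<in> cball 0 1 \<Longrightarrow> u z \<noteq> 0) \<Longrightarrow>
    (\<And>z. z \<in> cball 0 1 \<Longrightarrow> q z = u z + h z * g z) \<Longrightarrow> unit_mod g q"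
  unfolding unit_mod_def by blast

lemma unit_modE:
  assumes "unit_mod g q"
  obtains u h where "u \<in> real_disc_algebra" "h \<in> real_disc_algebra"
    "\<And>z. z \<in> cball 0 1 \<Longrightarrow> u z \<noteq> 0" "\<And>z. z \<in> cball 0 1 \<Longrightarrow> q z = u z + h z * g z"
  using assms unfolding unit_mod_def by blast

lemma unit_mod_unit:
  assumes "q \<in> real_disc_algebra" "\<And>z. z \<in> cball 0 1 \<Longrightarrow> q z \<noteq> 0"
  shows "unit_mod g q"
  by (rule unit_modI[OF assms(1) real_disc_algebra_const[of 0]]) (use assms(2) in auto)

lemma unit_mod_mult:
  assumes "g \<in> real_disc_algebra" "unit_mod g p" "unit_mod g q"
  shows "unit_mod g (\<lambda>z. p z * q z)"
proof -
  obtain u h where u: "u \<in> real_disc_algebra" "h \<in> real_disc_algebra"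
    "\<And>z. z \<in> cball 0 1 \<Longrightarrow> u z \<noteq> 0" "\<And>z. z \<in> cball 0 1 \<Longrightarrow> p z = u z + h z * g z"
    using unit_modE[OF assms(2)] by metis
  obtain v k where v: "v \<in> real_disc_algebra" "k \<in> real_disc_algebra"
    "\<And>z. z \<in> cball 0 1 \<Longrightarrow> v z \<noteq> 0" "\<And>z. z \<in> cball 0 1 \<Longrightarrow> q z = v z + k z * g z"
    using unit_modE[OF assms(3)] by metis
  show ?thesis
  proof (rule unit_modI)
    show "(\<lambda>z. u z * v z) \<in> real_disc_algebra" "(\<lambda>z. u z * k z + h z * v z + h z * k z * g z) \<in> real_disc_algebra"
      by (intro real_disc_algebra_intros u v assms)+
    show "u z * v z \<noteq> 0" if "z \<in> cball 0 1" for z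
      using u(3)[OF that] v(3)[OF that] by simp
    show "p z * q z = u z * v z + (u z * k z + h z * v z + h z * k z * g z) * g z" if "z \<in> cball 0 1" for z
      unfolding u(4)[OF that] v(4)[OF that] by (simp add: algebra_simps)
  qed
qed

text \<open>Multiplying the Bezout equation by \<open>q - p\<close> shows that \<open>q\<close> is
  congruent to \<open>p w\<close> modulo \<open>g\<close>, where \<open>w = 1 + x (q - p)\<close> is
  a unit.\<close>

lemma unit_mod_perturb:
  assumes g: "g \<in> real_disc_algebra" and p: "p \<in> real_disc_algebra" and q: "q \<in> real_disc_algebra"
    and x: "x \<in> real_disc_algebra" and y: "y \<in> real_disc_algebra"
    and bezout: "\<And>z. z \<in> cball 0 1 \<Longrightarrow> x z * p z + y z * g z = 1"
    and near: "\<And>z. z \<in> cball 0 1 \<Longrightarrow> cmod (x z * (q z - p z)) < 1"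
  shows "unit_mod g p \<longleftrightarrow> unit_mod g q"
proof -
  define w where "w = (\<lambda>z. 1 + x z * (q z - p z))"
  have w: "w \<in> real_disc_algebra"
    unfolding w_def by (intro real_disc_algebra_intros x q p) simp
  have w0: "w z \<noteq> 0" if "z \<in> cball 0 1" for z
    using one_minus_nonzero(2)[OF order_refl near[OF that]] by (simp add: w_def)
  have eq: "q z = p z * w z + (y z * (q z - p z)) * g z" if "z \<in> cball 0 1" for z
  proof -
    have "q z - p z = (x z * p z + y z * g z) * (q z - p z)"
      using bezout[OF that] by simp
    then show ?thesis by (simp add: w_def algebra_simps)
  qed
  show ?thesis
  proof
    assume "unit_mod g p"
    then obtain u h where u: "u \<in> real_disc_algebra" "h \<in> real_disc_algebra"
      "\<And>z. z \<in> cball 0 1 \<Longrightarrow> u z \<noteq> 0" "\<And>z. z \<in> cball 0 1 \<Longrightarrow> p z = u z + h z * g z"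
      using unit_modE by metis
    show "unit_mod g q"
    proof (rule unit_modI)
      show "(\<lambda>z. u z * w z) \<in> real_disc_algebra" "(\<lambda>z. h z * w z + y z * (q z - p z)) \<in> real_disc_algebra"
        by (intro real_disc_algebra_intros u w y q p)+
      show "u z * w z \<noteq> 0" if "z \<in> cball 0 1" for z
        using u(3)[OF that] w0[OF that] by simp
      show "q z = u z * w z + (h z * w z + y z * (q z - p z)) * g z" if "z \<in> cball 0 1" for z
      proof -
        have "q z = (u z + h z * g z) * w z + (y z * (q z - p z)) * g z"
          using eq[OF that] unfolding u(4)[OF that] .
        then show ?thesis by (simp add: algebra_simps)
      qed
    qed
  next
    assume "unit_mod g q"
    then obtain u h where u: "u \<in> real_disc_algebra" "h \<in> real_disc_algebra"
      "\<And>z. z \<in> cball 0 1 \<Longrightarrow> u z \<noteq> 0" "\<And>z. z \<in> cball 0 1 \<Longrightarrow> q z = u z + h z * g z"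
      using unit_modE by metis
    show "unit_mod g p"
    proof (rule unit_modI)
      show "(\<lambda>z. u z / w z) \<in> real_disc_algebra" "(\<lambda>z. (h z - y z * (q z - p z)) / w z) \<in> real_disc_algebra"
        by (intro real_disc_algebra_intros u w y q p w0; assumption)+
      show "u z / w z \<noteq> 0" if "z \<in> cball 0 1" for z
        using u(3)[OF that] w0[OF that] by simp
      show "p z = u z / w z + (h z - y z * (q z - p z)) / w z * g z" if "z \<in> cball 0 1" for z
      proof -
        have "p z * w z = u z + (h z - y z * (q z - p z)) * g z"
          using eq[OF that] u(4)[OF that] by (simp add: algebra_simps)
        then have "p z = (u z + (h z - y z * (q z - p z)) * g z) / w z"
          using w0[OF that] by (metis nonzero_mult_div_cancel_right)
        then show ?thesis by (simp add: add_divide_distrib)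
      qed
    qed
  qed
qed

text \<open>By \<open>unit_mod_perturb\<close> the property is locally constant in the parameter.
  The parameter space is left general because zeros will move both in the plane and along real
  intervals.\<close>

lemma unit_mod_homotopy:
  fixes q :: "'a::metric_space \<Rightarrow> complex \<Rightarrow> complex"
  assumes g: "g \<in> real_disc_algebra" and S: "connected S" and ab: "a \<in> S" "b \<in> S"
    and q: "\<And>s. s \<in> S \<Longrightarrow> q s \<in> real_disc_algebra"
    and nz: "\<And>s z. s \<in> S \<Longrightarrow> z \<in> cball 0 1 \<Longrightarrow> q s z \<noteq> 0 \<or> g z \<noteq> 0"
    and cont: "continuous_on (S \<times> cball 0 1) (\<lambda>(s, z). q s z)"
    and "unit_mod g (q a)"
  shows "unit_mod g (q b)"
proof (rule connected_induction_simple[where P = "\<lambda>s. unit_mod g (q s)", OF S ab \<open>unit_mod g (q a)\<close>])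
  fix s assume s: "s \<in> S"
  obtain x y where x: "x \<in> real_disc_algebra" and y: "y \<in> real_disc_algebra"
    and xy: "\<And>z. z \<in> cball 0 1 \<Longrightarrow> x z * q s z + y z * g z = 1"
    using real_disc_algebra_corona[OF q[OF s] g nz[OF s]] by blast
  obtain B where B: "B > 0" "\<And>z. z \<in> cball 0 1 \<Longrightarrow> cmod (x z) \<le> B"
    using disc_algebra_bounded[OF real_disc_algebra_imp_disc_algebra[OF x]] by blast
  have "1 / (2 * B) > 0" using B(1) by simp
  \<comment> \<open>Compactness of the disc gives a neighbourhood of \<open>s\<close> that works for
    all \<open>z\<close> at once.\<close>
  then obtain X where X: "s \<in> X" "open X"
    "\<forall>t\<in>X \<inter> S. \<forall>z\<in>cball 0 1. dist (case (t, z) of (s, z) \<Rightarrow> q s z) (case (s, z) of (s, z) \<Rightarrow> q s z) \<le> 1 / (2 * B)"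
    by (rule continuous_on_prod_compactE[OF cont compact_cball s])
  have *: "unit_mod g (q s) \<longleftrightarrow> unit_mod g (q t)" if t: "t \<in> X \<inter> S" for t
  proof (rule unit_mod_perturb[OF g q[OF s] q x y xy])
    fix z :: complex assume z: "z \<in> cball 0 1"
    have "cmod (x z * (q t z - q s z)) \<le> B * (1 / (2 * B))"
      unfolding norm_mult using B(1) B(2)[OF z] X(3)[rule_format, OF t z] by (intro mult_mono) (simp_all add: dist_norm)
    also have "\<dots> < 1" using B(1) by simp
    finally show "cmod (x z * (q t z - q s z)) < 1" .
  qed (use t in auto)
  show "\<exists>T. openin (top_of_set S) T \<and> s \<in> T \<and> (\<forall>t\<in>T. \<forall>t'\<in>T. unit_mod g (q t) \<longrightarrow> unit_mod g (q t'))"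
  proof (intro exI conjI ballI impI)
    show "openin (top_of_set S) (X \<inter> S)"
      unfolding Int_commute[of X] by (rule openin_open_Int[OF X(2)])
    show "s \<in> X \<inter> S" using X(1) s by simp
    show "unit_mod g (q t')" if "t \<in> X \<inter> S" "t' \<in> X \<inter> S" "unit_mod g (q t)" for t t'
      using that(3) unfolding *[OF that(1), symmetric] *[OF that(2), symmetric] .
  qed
qed

text \<open>The complement is taken in the whole plane. A component inside the closed disc would
  have its frontier in the zero set, so the maximum principle would make \<open>g\<close> vanish on
  it; hence every component reaches the connected exterior of the disc.\<close>

lemma connected_nonzero_set:
  assumes g: "g \<in> disc_algebra"
  shows "connected (- {z \<in> cball 0 1. g z = 0})" (is "connected (- ?E)")
proof -
  have "closed ?E"
    by (rule continuous_closed_preimage_constant) (use g in \<open>auto simp: disc_algebra_def\<close>)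
  then have "open (- ?E)" by blast
  have out: "connected (- cball (0::complex) 1)"
    by (rule connected_complement_bounded_convex) auto
  have "connected_component (- ?E) a 2" if a: "a \<in> - ?E" for a
  proof -
    define C where "C = connected_component_set (- ?E) a"
    have "a \<in> C" using a by (simp add: C_def connected_component_refl)
    have "open C" unfolding C_def using \<open>open (- ?E)\<close> by (rule open_connected_component)
    show ?thesis
    proof (cases "C \<subseteq> cball 0 1")
      case True
      then have "C \<subseteq> interior (cball 0 1)"
        using \<open>open C\<close> by (rule interior_maximal)
      then have C: "C \<subseteq> ball 0 1" by simp
      have "cmod (g a) \<le> 0"
      proof (rule maximum_modulus_frontier[of g C])
        show "g holomorphic_on interior C"
          using g C \<open>open C\<close> by (auto simp: disc_algebra_def interior_open intro: holomorphic_on_subset)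
        show "continuous_on (closure C) g"
          using g closure_minimal[OF True closed_cball] by (auto simp: disc_algebra_def intro: continuous_on_subset)
        show "bounded C" using bounded_subset[OF bounded_cball True] .
        show "a \<in> C" by fact
        fix z assume "z \<in> frontier C"
        then have "z \<in> frontier ?E"
          using frontier_of_connected_component_subset[of "- ?E" a] unfolding C_def frontier_complement by blast
        then show "cmod (g z) \<le> 0"
          using frontier_subset_closed[OF \<open>closed ?E\<close>] by auto
      qed
      then show ?thesis using a \<open>a \<in> C\<close> True by auto
    next
      case False
      then obtain b where b: "b \<in> C" "b \<in> - cball 0 1" by blast
      have "connected_component (- ?E) b 2"
        unfolding connected_component_def
        by (rule exI[of _ "- cball 0 1"]) (use out b in auto)
      with b(1) show ?thesis
        unfolding C_def by (auto intro: connected_component_trans)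
    qed
  qed
  then show ?thesis
    unfolding connected_iff_connected_component
    by (meson connected_component_sym connected_component_trans)
qed

text \<open>One zero travels to 2 through the complement of the zero set of \<open>g\<close>, the
  other follows by conjugation and avoids that set by its symmetry.\<close>

lemma unit_mod_conjugate_pair:
  assumes g: "g \<in> real_disc_algebra" and a: "a \<in> cball 0 1 \<Longrightarrow> g a \<noteq> 0"
  shows "unit_mod g (\<lambda>z. (z - a) * (z - cnj a))"
proof (rule unit_mod_homotopy[OF g connected_nonzero_set, of g 2 a "\<lambda>s z. (z - s) * (z - cnj s)"])
  show "g \<in> disc_algebra" using g by (rule real_disc_algebra_imp_disc_algebra)
  show "2 \<in> - {z \<in> cball 0 1. g z = 0}" "a \<in> - {z \<in> cball 0 1. g z = 0}"
    using a by auto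
  show mem: "(\<lambda>z. (z - s) * (z - cnj s)) \<in> real_disc_algebra" for s
    by (intro real_disc_algebraI disc_algebra_intros) (simp add: mult.commute)
  show "unit_mod g (\<lambda>z. (z - 2) * (z - cnj 2))"
    by (rule unit_mod_unit[OF mem]) auto
  show "(z - s) * (z - cnj s) \<noteq> 0 \<or> g z \<noteq> 0"
    if s: "s \<in> - {z \<in> cball 0 1. g z = 0}" and z: "z \<in> cball 0 1" for s z
  proof (rule ccontr)
    assume "\<not> ?thesis"
    then have *: "z = s \<or> cnj z = s" "g z = 0" by auto
    have "g (cnj z) = 0"
      using real_disc_algebra_cnj[OF g z] * by simp
    then show False using * s z by auto
  qed
  show "continuous_on ((- {z \<in> cball 0 1. g z = 0}) \<times> cball 0 1) (\<lambda>(s, z). (z - s) * (z - cnj s))"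
    unfolding case_prod_unfold by (intro continuous_intros)
qed

text \<open>A single real zero may slide along an interval free of zeros of \<open>g\<close>, while
  the cofactor \<open>r\<close> stays fixed.\<close>

lemma unit_mod_real_segment:
  fixes q :: "real \<Rightarrow> complex \<Rightarrow> complex"
  assumes g: "g \<in> real_disc_algebra" and r: "r \<in> real_disc_algebra"
    and ab: "a \<in> {c..d}" "b \<in> {c..d}"
    and nz: "\<And>t. c \<le> t \<Longrightarrow> t \<le> d \<Longrightarrow> -1 \<le> t \<Longrightarrow> t \<le> 1 \<Longrightarrow> g (of_real t) \<noteq> 0"
    and rnz: "\<And>z. z \<in> cball 0 1 \<Longrightarrow> r z \<noteq> 0 \<or> g z \<noteq> 0"
    and "unit_mod g (\<lambda>z. r z * (z - of_real a))"
  shows "unit_mod g (\<lambda>z. r z * (z - of_real b))"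
proof (rule unit_mod_homotopy[OF g connected_Icc ab, of "\<lambda>s z. r z * (z - of_real s)"])
  show "(\<lambda>z. r z * (z - of_real s)) \<in> real_disc_algebra" for s
    by (intro real_disc_algebra_intros r) simp
  show "r z * (z - of_real s) \<noteq> 0 \<or> g z \<noteq> 0" if "s \<in> {c..d}" "z \<in> cball 0 1" for s z
  proof (cases "z = of_real s")
    case True
    then have "\<bar>s\<bar> \<le> 1" using that(2) by simp
    then show ?thesis using nz[of s] that(1) True by auto
  next
    case False
    then show ?thesis using rnz[OF that(2)] by simp
  qed
  show "continuous_on ({c..d} \<times> cball 0 1) (\<lambda>(s, z). r z * (z - of_real s))"
  proof -
    have "continuous_on (cball 0 1) r"
      using r by (simp add: real_disc_algebra_def disc_algebra_def)
    then have "continuous_on ({c..d} \<times> cball 0 1) (\<lambda>x. r (snd x))"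
      by (rule continuous_on_compose2[OF _ continuous_on_snd[OF continuous_on_id]])
        (rule image_subsetI, simp add: mem_Times_iff)
    then show ?thesis
      unfolding case_prod_unfold by (intro continuous_intros)
  qed
qed fact

section \<open>Moving the zeros of real polynomials\<close>

text \<open>Coefficients stay in \<open>complex\<close> so that roots exist and evaluation needs no
  coercion.\<close>

definition real_poly :: "complex poly \<Rightarrow> bool" where
  "real_poly p \<longleftrightarrow> map_poly cnj p = p"

lemma real_poly_cnj: "real_poly p \<Longrightarrow> poly p (cnj z) = cnj (poly p z)"
  unfolding real_poly_def by (metis poly_cnj)

lemma real_polyI:
  assumes "\<And>z. poly p (cnj z) = cnj (poly p z)"
  shows "real_poly p"
proof -
  have "poly (map_poly cnj p) = poly p"
    by (rule ext) (simp add: assms)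
  then show ?thesis
    unfolding real_poly_def poly_eq_poly_eq_iff .
qed

lemma real_poly_real_value:
  assumes "real_poly p"
  shows "poly p (of_real t) = of_real (Re (poly p (of_real t)))"
proof -
  have "cnj (poly p (of_real t)) = poly p (of_real t)"
    using real_poly_cnj[OF assms, of "of_real t"] by simp
  then show ?thesis by (simp add: complex_eq_iff)
qed

text \<open>Conjugating the coefficients of \<open>q * s\<close> fixes the product and
  \<open>q\<close>, so \<open>q\<close> can be cancelled.\<close>

lemma real_poly_cofactor:
  assumes "real_poly (q * s)" "real_poly q" "q \<noteq> 0"
  shows "real_poly s"
proof -
  have "q * map_poly cnj s = q * s"
  proof (rule poly_eq_poly_eq_iff[THEN iffD1], rule ext)
    fix z
    have "poly (q * s) z = cnj (poly (q * s) (cnj z))"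
      using real_poly_cnj[OF assms(1)] by simp
    also have "\<dots> = poly (q * map_poly cnj s) z"
      using real_poly_cnj[OF assms(2)] by simp
    finally show "poly (q * map_poly cnj s) z = poly (q * s) z" ..
  qed
  then show ?thesis
    using assms(3) by (simp add: real_poly_def)
qed

lemma real_poly_real_disc_algebra:
  assumes "real_poly p"
  shows "poly p \<in> real_disc_algebra"
proof (rule real_disc_algebraI)
  show "poly p \<in> disc_algebra"
    by (rule holomorphic_imp_disc_algebra[of _ UNIV]) (auto intro: holomorphic_intros)
qed (rule real_poly_cnj[OF assms])

lemma real_poly_linear: "real_poly [:- complex_of_real a, 1:]" "real_poly [:complex_of_real a, - 1:]"
  by (rule real_polyI; simp)+

lemma real_poly_mult: "real_poly p \<Longrightarrow> real_poly q \<Longrightarrow> real_poly (p * q)"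
  by (rule real_polyI) (simp add: real_poly_cnj)

text \<open>The zero slides to the right out of the disc. The sign makes the factor positive to the
  left of \<open>a\<close>, where the real zeros of \<open>g\<close> lie.\<close>

lemma unit_mod_linear_above:
  assumes g: "g \<in> real_disc_algebra"
    and nz: "\<And>t. a \<le> t \<Longrightarrow> -1 \<le> t \<Longrightarrow> t \<le> 1 \<Longrightarrow> g (of_real t) \<noteq> 0"
  shows "unit_mod g (\<lambda>z. -1 * (z - of_real a))"
proof (rule unit_mod_real_segment[OF g, of _ "max a 2" a "max a 2"])
  show "unit_mod g (\<lambda>z. -1 * (z - of_real (max a 2)))"
  proof (rule unit_mod_unit)
    show "-1 * (z - of_real (max a 2)) \<noteq> 0" if "z \<in> cball 0 1" for z :: complex
    proof
      assume "-1 * (z - of_real (max a 2)) = 0"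
      then have "z = of_real (max a 2)" by simp
      then have "cmod z = \<bar>max a 2\<bar>" by (simp only: norm_of_real)
      then show False using that by simp
    qed
  qed (intro real_disc_algebra_intros; simp)
qed (use nz in \<open>auto intro!: real_disc_algebra_intros\<close>)

lemma unit_mod_linear_below:
  assumes g: "g \<in> real_disc_algebra"
    and nz: "\<And>t. t \<le> a \<Longrightarrow> -1 \<le> t \<Longrightarrow> t \<le> 1 \<Longrightarrow> g (of_real t) \<noteq> 0"
  shows "unit_mod g (\<lambda>z. 1 * (z - of_real a))"
proof (rule unit_mod_real_segment[OF g, of _ "min a (-2)" "min a (-2)" a])
  show "unit_mod g (\<lambda>z. 1 * (z - of_real (min a (-2))))"
  proof (rule unit_mod_unit)
    show "1 * (z - of_real (min a (-2))) \<noteq> 0" if "z \<in> cball 0 1" for z :: complex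
    proof
      assume "1 * (z - of_real (min a (-2))) = 0"
      then have "z = of_real (min a (-2))" by simp
      then have "cmod z = \<bar>min a (-2)\<bar>" by (simp only: norm_of_real)
      then show False using that by simp
    qed
  qed (intro real_disc_algebra_intros; simp)
qed (use nz in \<open>auto intro!: real_disc_algebra_intros\<close>)

text \<open>Sliding \<open>b\<close> onto \<open>a\<close> turns the pair into a double zero, the
  degenerate conjugate pair \<open>a = cnj a\<close>.\<close>

lemma unit_mod_real_pair:
  assumes g: "g \<in> real_disc_algebra"
    and nz: "\<And>t. c \<le> t \<Longrightarrow> t \<le> d \<Longrightarrow> -1 \<le> t \<Longrightarrow> t \<le> 1 \<Longrightarrow> g (of_real t) \<noteq> 0"
    and ab: "a \<in> {c..d}" "b \<in> {c..d}"
  shows "unit_mod g (\<lambda>z. (z - of_real a) * (z - of_real b))"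
proof (rule unit_mod_real_segment[OF g _ ab nz])
  have ga: "g (of_real a) \<noteq> 0" if "complex_of_real a \<in> cball 0 1"
    using nz[of a] ab that by (auto simp: abs_le_iff)
  show "unit_mod g (\<lambda>z. (z - of_real a) * (z - of_real a))"
    using unit_mod_conjugate_pair[OF g ga] by simp
  show "z - of_real a \<noteq> 0 \<or> g z \<noteq> 0" if "z \<in> cball 0 1" for z
    using ga that by (cases "z = of_real a") auto
  show "(\<lambda>z. z - of_real a) \<in> real_disc_algebra"
    by (intro real_disc_algebra_intros) simp
qed

text \<open>Applied to the cofactor \<open>s\<close> of a real zero \<open>a\<close> of \<open>(z - a) s\<close>, with \<open>T\<close> the real zero set of \<open>g\<close>.\<close>

lemma real_zero_partner:
  assumes p: "real_poly s" and T: "compact T"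
    and pos: "\<And>t. t \<in> T \<Longrightarrow> (t - a) * Re (poly s (of_real t)) > 0"
    and lr: "l \<in> T" "l < a" "r \<in> T" "a < r"
  obtains b c d where "a \<in> {c..d}" "b \<in> {c..d}" "{c..d} \<inter> T = {}" "poly s (of_real b) = 0"
proof -
  have "compact (T \<inter> {..a})" "compact (T \<inter> {a..})"
    using T by (auto intro: compact_Int_closed)
  moreover have "T \<inter> {..a} \<noteq> {}" "T \<inter> {a..} \<noteq> {}"
    using lr by auto
  \<comment> \<open>The points of \<open>T\<close> nearest to \<open>a\<close> on either side. By
    \<open>pos\<close> the cofactor changes sign between them, and its zero \<open>b\<close> lies
    with \<open>a\<close> in the same gap of \<open>T\<close>.\<close>
  ultimately obtain l' r' where l': "l' \<in> T \<inter> {..a}" "\<And>t. t \<in> T \<inter> {..a} \<Longrightarrow> t \<le> l'"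
    and r': "r' \<in> T \<inter> {a..}" "\<And>t. t \<in> T \<inter> {a..} \<Longrightarrow> r' \<le> t"
    by (metis compact_attains_sup compact_attains_inf)
  have ne: "a \<notin> T" using pos[of a] by auto
  have "l' < a" "a < r'" using l' r' ne by (auto simp: less_le)
  have signs: "Re (poly s (of_real l')) < 0" "0 < Re (poly s (of_real r'))"
    using pos[of l'] pos[of r'] l' r' \<open>l' < a\<close> \<open>a < r'\<close> by (auto simp: zero_less_mult_iff)
  have "\<exists>b\<ge>l'. b \<le> r' \<and> Re (poly s (of_real b)) = 0"
    by (rule IVT') (use signs \<open>l' < a\<close> \<open>a < r'\<close> in \<open>auto intro!: continuous_intros\<close>)
  then obtain b where b: "l' \<le> b" "b \<le> r'" "Re (poly s (of_real b)) = 0" by blast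
  have "l' \<noteq> b" "r' \<noteq> b" using signs b by auto
  then have b': "l' < b" "b < r'" using b by auto
  show thesis
  proof (rule that[of "min a b" "max a b" b])
    show "poly s (of_real b) = 0"
      using real_poly_real_value[OF p, of b] b(3) by simp
    show "{min a b..max a b} \<inter> T = {}"
    proof (rule ccontr)
      assume "{min a b..max a b} \<inter> T \<noteq> {}"
      then obtain t where t: "t \<in> T" "min a b \<le> t" "t \<le> max a b" by auto
      then show False
        using l'(2)[of t] r'(2)[of t] b' \<open>l' < a\<close> \<open>a < r'\<close> by (cases "t \<le> a") auto
    qed
  qed auto
qed

text \<open>Induction on the degree, splitting off a factor that is a unit modulo \<open>g\<close>
  and nonnegative at the real zeros of \<open>g\<close>: a conjugate pair, a real zero beyond all
  real zeros of \<open>g\<close> on one side, or two real zeros in one gap.\<close>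

theorem unit_mod_real_poly:
  assumes g: "g \<in> real_disc_algebra" and "real_poly p"
    and "\<And>z. z \<in> cball 0 1 \<Longrightarrow> g z = 0 \<Longrightarrow> poly p z \<noteq> 0"
    and "\<And>t. -1 \<le> t \<Longrightarrow> t \<le> 1 \<Longrightarrow> g (of_real t) = 0 \<Longrightarrow> Re (poly p (of_real t)) > 0"
  shows "unit_mod g (poly p)"
  using assms(2-)
proof (induction "degree p" arbitrary: p rule: less_induct)
  case less
  note p = less.prems
  \<comment> \<open>Nonnegativity of \<open>q\<close> suffices: as \<open>p = q s\<close> is
    positive at the real zeros of \<open>g\<close>, so is \<open>s\<close>, and the induction
    hypothesis applies to it.\<close>
  have factor: "unit_mod g (poly p)"
    if ps: "p = q * s" and q: "real_poly q" "degree q > 0" "unit_mod g (poly q)" and "p \<noteq> 0"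
      and pos: "\<And>t. -1 \<le> t \<Longrightarrow> t \<le> 1 \<Longrightarrow> g (of_real t) = 0 \<Longrightarrow> Re (poly q (of_real t)) \<ge> 0"
    for q s
  proof -
    have nz: "q \<noteq> 0" "s \<noteq> 0" using ps \<open>p \<noteq> 0\<close> by auto
    have s: "real_poly s"
      using real_poly_cofactor[of q s] p(1) ps q(1) nz by simp
    have "unit_mod g (poly s)"
    proof (rule less.hyps[OF _ s])
      show "degree s < degree p"
        unfolding ps using nz q(2) by (simp add: degree_mult_eq)
      show "poly s z \<noteq> 0" if "z \<in> cball 0 1" "g z = 0" for z
        using p(2)[OF that] by (simp add: ps)
      show "Re (poly s (of_real t)) > 0" if t: "-1 \<le> t" "t \<le> 1" "g (of_real t) = 0" for t
      proof -
        have "poly p (of_real t) = of_real (Re (poly q (of_real t))) * of_real (Re (poly s (of_real t)))"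
          using real_poly_real_value[OF q(1), of t] real_poly_real_value[OF s, of t] by (simp add: ps)
        then have "Re (poly p (of_real t)) = Re (poly q (of_real t)) * Re (poly s (of_real t))"
          by simp
        then show ?thesis
          using p(3)[OF t] pos[OF t] by (auto simp: zero_less_mult_iff)
      qed
    qed
    then show ?thesis
      using unit_mod_mult[OF g q(3)] by (simp add: ps[THEN arg_cong, of poly] poly_mult[abs_def])
  qed
  show ?case
  proof (cases "degree p = 0")
    case True
    then obtain c where c: "p = [:c:]" by (rule degree_eq_zeroE)
    have "Im c = 0"
      using real_poly_real_value[OF p(1), of 0] by (simp add: c complex_eq_iff)
    show ?thesis
    proof (cases "c = 0")
      \<comment> \<open>For \<open>p = 0\<close> the function \<open>g\<close> has no zero on the
        disc, and \<open>0 = 1 + (-1 / g) g\<close>.\<close>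
      case True
      then have gnz: "g z \<noteq> 0" if "z \<in> cball 0 1" for z
        using p(2)[OF that] by (auto simp: c)
      show ?thesis
      proof (rule unit_modI)
        show "(\<lambda>_. 1) \<in> real_disc_algebra" "(\<lambda>z. -1 / g z) \<in> real_disc_algebra"
          using gnz by (intro real_disc_algebra_intros g; simp)+
      qed (use gnz True in \<open>auto simp: c\<close>)
    next
      case False
      then show ?thesis
        by (intro unit_mod_unit real_poly_real_disc_algebra p(1)) (simp add: c)
    qed
  next
    case False
    then have "p \<noteq> 0" by auto
    obtain a where a: "poly p a = 0"
      using alg_closed_imp_poly_has_root[of p] False by auto
    then obtain s where s: "p = [:-a, 1:] * s"
      by (auto simp: poly_eq_0_iff_dvd elim: dvdE)
    have ga: "g a \<noteq> 0" if "a \<in> cball 0 1"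
      using p(2)[OF that] a by blast
    show ?thesis
    proof (cases "Im a = 0")
      case False
      then have "cnj a \<noteq> a" by (simp add: complex_eq_iff)
      moreover have "poly p (cnj a) = 0"
        using real_poly_cnj[OF p(1), of a] a by simp
      ultimately have "poly s (cnj a) = 0" by (simp add: s)
      then obtain s' where s': "s = [:-cnj a, 1:] * s'"
        by (auto simp: poly_eq_0_iff_dvd elim: dvdE)
      have q: "poly ([:-a, 1:] * [:-cnj a, 1:]) = (\<lambda>z. (z - a) * (z - cnj a))"
        by (rule ext) (simp add: algebra_simps)
      show ?thesis
      proof (rule factor[of "[:-a, 1:] * [:-cnj a, 1:]" s'])
        show "p = [:-a, 1:] * [:-cnj a, 1:] * s'"
          by (simp only: s s' mult.assoc)
        show "real_poly ([:-a, 1:] * [:-cnj a, 1:])"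
          by (rule real_polyI) (simp only: q, simp)
        show "unit_mod g (poly ([:-a, 1:] * [:-cnj a, 1:]))"
          unfolding q by (rule unit_mod_conjugate_pair[OF g ga])
        show "Re (poly ([:-a, 1:] * [:-cnj a, 1:]) (of_real t)) \<ge> 0" for t
          unfolding q by simp
      qed (use \<open>p \<noteq> 0\<close> in simp_all)
    next
      case True
      define \<alpha> where "\<alpha> = Re a"
      have \<alpha>: "a = of_real \<alpha>" using True by (simp add: \<alpha>_def complex_eq_iff)
      define T where "T = {t \<in> {-1..1}. g (of_real t) = 0}"
      have "continuous_on {-1..1} (\<lambda>t. g (complex_of_real t))"
      proof (rule continuous_on_compose2[of "cball 0 1" g])
        show "continuous_on (cball 0 1) g"
          using g by (simp add: real_disc_algebra_def disc_algebra_def)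
        show "complex_of_real ` {-1..1} \<subseteq> cball 0 1" by (auto simp: abs_le_iff)
      qed (intro continuous_intros)
      then have "closed T"
        unfolding T_def by (rule continuous_closed_preimage_constant) simp
      moreover have "bounded T"
        by (rule bounded_subset[OF bounded_closed_interval[of "-1" 1]]) (auto simp: T_def)
      ultimately have "compact T"
        by (simp add: compact_eq_bounded_closed)
      have nT: "g (of_real t) \<noteq> 0" if "t \<notin> T" "-1 \<le> t" "t \<le> 1" for t
        using that by (auto simp: T_def)
      have pT: "Re (poly p (of_real t)) > 0" if "t \<in> T" for t
        using p(3)[of t] that by (auto simp: T_def)
      have "\<alpha> \<notin> T" using pT[of \<alpha>] a \<alpha> by auto
      \<comment> \<open>An empty \<open>T\<close> is covered by the first two cases.\<close>
      consider "\<And>t. t \<in> T \<Longrightarrow> t < \<alpha>" | "\<And>t. t \<in> T \<Longrightarrow> \<alpha> < t" | l r where "l \<in> T" "l < \<alpha>" "r \<in> T" "\<alpha> < r"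
        using \<open>\<alpha> \<notin> T\<close> by (metis linorder_neqE)
      then show ?thesis
      proof cases
        case 1
        have q: "poly [:a, -1:] = (\<lambda>z. -1 * (z - of_real \<alpha>))"
          by (rule ext) (simp add: \<alpha>)
        show ?thesis
        proof (rule factor[of "[:a, -1:]" "- s"])
          show "p = [:a, -1:] * (- s)" by (simp add: s)
          show "real_poly [:a, -1:]" unfolding \<alpha> by (rule real_poly_linear)
          show "unit_mod g (poly [:a, -1:])"
            unfolding q by (rule unit_mod_linear_above[OF g nT]) (use 1 in \<open>auto dest: leD\<close>)
          show "Re (poly [:a, -1:] (of_real t)) \<ge> 0" if "-1 \<le> t" "t \<le> 1" "g (of_real t) = 0" for t
            using 1[of t] that by (simp add: q T_def)
        qed (use \<open>p \<noteq> 0\<close> in simp_all)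
      next
        case 2
        have q: "poly [:-a, 1:] = (\<lambda>z. 1 * (z - of_real \<alpha>))"
          by (rule ext) (simp add: \<alpha>)
        show ?thesis
        proof (rule factor[OF s])
          show "real_poly [:-a, 1:]" unfolding \<alpha> by (rule real_poly_linear)
          show "unit_mod g (poly [:-a, 1:])"
            unfolding q by (rule unit_mod_linear_below[OF g nT]) (use 2 in \<open>auto dest: leD\<close>)
          show "Re (poly [:-a, 1:] (of_real t)) \<ge> 0" if "-1 \<le> t" "t \<le> 1" "g (of_real t) = 0" for t
            using 2[of t] that by (simp add: q T_def)
        qed (use \<open>p \<noteq> 0\<close> in simp_all)
      next
        case 3
        have "real_poly s"
          using real_poly_cofactor[of "[:-a, 1:]" s] p(1) real_poly_linear(1)[of \<alpha>] by (simp add: s \<alpha>)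
        moreover have "(t - \<alpha>) * Re (poly s (of_real t)) > 0" if "t \<in> T" for t
          using pT[OF that] by (simp add: s \<alpha> algebra_simps)
        ultimately obtain b c d where b: "\<alpha> \<in> {c..d}" "b \<in> {c..d}" "{c..d} \<inter> T = {}" "poly s (of_real b) = 0"
          using real_zero_partner[OF _ \<open>compact T\<close> _ 3] by metis
        then obtain s' where s': "s = [:-of_real b, 1:] * s'"
          by (auto simp: poly_eq_0_iff_dvd elim: dvdE)
        have q: "poly ([:-a, 1:] * [:-of_real b, 1:]) = (\<lambda>z. (z - of_real \<alpha>) * (z - of_real b))"
          by (rule ext) (simp add: algebra_simps \<alpha>)
        show ?thesis
        proof (rule factor[of "[:-a, 1:] * [:-of_real b, 1:]" s'])
          show "p = [:-a, 1:] * [:-of_real b, 1:] * s'"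
            by (simp only: s s' mult.assoc)
          show "real_poly ([:-a, 1:] * [:-of_real b, 1:])"
            unfolding \<alpha> by (intro real_poly_mult real_poly_linear)
          show "unit_mod g (poly ([:-a, 1:] * [:-of_real b, 1:]))"
            unfolding q by (rule unit_mod_real_pair[OF g nT b(1,2)]) (use b(3) in auto)
          show "Re (poly ([:-a, 1:] * [:-of_real b, 1:]) (of_real t)) \<ge> 0"
            if "-1 \<le> t" "t \<le> 1" "g (of_real t) = 0" for t
          proof -
            \<comment> \<open>A real zero of \<open>g\<close> lies on the same side of
              \<open>\<alpha>\<close> and \<open>b\<close>, so the two differences agree in
              sign.\<close>
            have "t \<notin> {c..d}" using b(3) that by (auto simp: T_def)
            then have "(t - \<alpha>) * (t - b) \<ge> 0"
              using b(1,2) by (auto simp: zero_le_mult_iff)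
            then show ?thesis unfolding q by simp
          qed
        qed (use \<open>p \<noteq> 0\<close> in simp_all)
      qed
    qed
  qed
qed

section \<open>Polynomial approximation and the conclusion\<close>

lemma disc_algebra_poly_approx:
  assumes f: "f \<in> disc_algebra" and "e > 0"
  obtains p where "\<And>z. z \<in> cball 0 1 \<Longrightarrow> cmod (poly p z - f z) < e"
proof -
  obtain r :: real where r: "0 < r" "r < 1" "\<And>z. z \<in> cball 0 1 \<Longrightarrow> cmod (f (of_real r * z) - f z) < e / 2"
    using disc_algebra_dilation_approx[OF f, of "e / 2"] \<open>e > 0\<close> by auto
  define F where "F = (\<lambda>z. f (of_real r * z))"
  \<comment> \<open>Taylor coefficients of a dilate; its series converges beyond the closed disc,
    hence uniformly on it.\<close>
  define a where "a = (\<lambda>n. (deriv ^^ n) F 0 / fact n)"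
  have sums: "(\<lambda>n. a n * z ^ n) sums F z" if "cmod z < 1 / r" for z
    using holomorphic_power_series[OF holomorphic_on_dilation[OF f r(1)], of z] that
    unfolding F_def a_def by (simp add: mem_ball_0 del: mem_ball)
  \<comment> \<open>A point of convergence strictly outside the closed disc shows that the radius of
    convergence exceeds 1.\<close>
  obtain \<rho> where \<rho>: "1 < \<rho>" "\<rho> < 1 / r"
    using dense[of 1 "1 / r"] r by auto
  have "summable (\<lambda>n. a n * complex_of_real \<rho> ^ n)"
    using sums[of "of_real \<rho>"] \<rho> by (auto simp: sums_iff)
  then have "ereal (norm (complex_of_real \<rho>)) \<le> conv_radius a"
    by (rule conv_radius_geI)
  moreover have "ereal 1 < ereal (norm (complex_of_real \<rho>))"
    using \<rho>(1) by simp
  ultimately have "ereal 1 < conv_radius a"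
    by (rule less_le_trans[rotated])
  then have "uniform_limit (cball 0 1) (\<lambda>n z. \<Sum>i<n. a i * (z - 0) ^ i) (\<lambda>z. \<Sum>i. a i * (z - 0) ^ i) sequentially"
    by (rule powser_uniform_limit)
  then have "\<forall>\<^sub>F n in sequentially. \<forall>z\<in>cball 0 1. dist (\<Sum>i<n. a i * (z - 0) ^ i) (\<Sum>i. a i * (z - 0) ^ i) < e / 2"
    using \<open>e > 0\<close> by (intro uniform_limitD) auto
  then obtain n where n: "\<forall>z\<in>cball 0 1. dist (\<Sum>i<n. a i * (z - 0) ^ i) (\<Sum>i. a i * (z - 0) ^ i) < e / 2"
    unfolding eventually_sequentially by blast
  show thesis
  proof (rule that[of "\<Sum>i<n. monom (a i) i"])
    fix z :: complex assume z: "z \<in> cball 0 1"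
    have "cmod z < 1 / r" using z \<rho> by auto
    then have "(\<Sum>i. a i * (z - 0) ^ i) = F z"
      using sums[of z] by (simp add: sums_iff)
    then have "cmod (poly (\<Sum>i<n. monom (a i) i) z - F z) < e / 2"
      using n[rule_format, OF z] by (simp add: dist_norm poly_sum poly_monom)
    moreover have "cmod (F z - f z) < e / 2"
      using r(3)[OF z] by (simp add: F_def)
    ultimately show "cmod (poly (\<Sum>i<n. monom (a i) i) z - f z) < e"
      using norm_triangle_ineq[of "poly (\<Sum>i<n. monom (a i) i) z - F z" "F z - f z"] by simp
  qed
qed

text \<open>Averaging with the reflected polynomial makes the coefficients real; the error does not
  grow because \<open>f\<close> is its own reflection.\<close>

lemma real_disc_algebra_poly_approx:
  assumes f: "f \<in> real_disc_algebra" and "e > 0"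
  obtains p where "real_poly p" "\<And>z. z \<in> cball 0 1 \<Longrightarrow> cmod (poly p z - f z) < e"
proof -
  obtain p where p: "\<And>z. z \<in> cball 0 1 \<Longrightarrow> cmod (poly p z - f z) < e"
    using disc_algebra_poly_approx[OF real_disc_algebra_imp_disc_algebra[OF f] \<open>e > 0\<close>] by blast
  define q where "q = smult (1/2) (p + map_poly cnj p)"
  have q: "poly q z = (poly p z + cnj (poly p (cnj z))) / 2" for z
    by (simp add: q_def)
  show thesis
  proof (rule that)
    show "real_poly q"
      by (rule real_polyI) (simp add: q add.commute)
    fix z :: complex assume z: "z \<in> cball 0 1"
    then have "cmod (poly p (cnj z) - f (cnj z)) < e"
      by (intro p) simp
    also have "poly p (cnj z) - f (cnj z) = cnj (cnj (poly p (cnj z)) - f z)"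
      using real_disc_algebra_cnj[OF f z] by simp
    finally have 1: "cmod (cnj (poly p (cnj z)) - f z) < e"
      by (simp only: complex_mod_cnj)
    have "poly q z - f z = ((poly p z - f z) + (cnj (poly p (cnj z)) - f z)) / 2"
      by (simp add: q field_simps)
    then have "cmod (poly q z - f z) = cmod ((poly p z - f z) + (cnj (poly p (cnj z)) - f z)) / 2"
      by (simp only: norm_divide) simp
    then show "cmod (poly q z - f z) < e"
      using norm_triangle_ineq[of "poly p z - f z" "cnj (poly p (cnj z)) - f z"] p[OF z] 1 by simp
  qed
qed

theorem unit_mod_if_positive_on_real_zeros:
  assumes f: "f \<in> real_disc_algebra" and g: "g \<in> real_disc_algebra"
    and "\<delta> > 0" and \<delta>: "\<And>z. z \<in> cball 0 1 \<Longrightarrow> \<delta> \<le> cmod (f z) + cmod (g z)"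
    and pos: "\<And>t. -1 \<le> t \<Longrightarrow> t \<le> 1 \<Longrightarrow> g (of_real t) = 0 \<Longrightarrow> Re (f (of_real t)) > 0"
  shows "unit_mod g f"
proof -
  have nz: "f z \<noteq> 0 \<or> g z \<noteq> 0" if "z \<in> cball 0 1" for z
    using \<delta>[OF that] \<open>\<delta> > 0\<close> by auto
  obtain x y where x: "x \<in> real_disc_algebra" and y: "y \<in> real_disc_algebra"
    and xy: "\<And>z. z \<in> cball 0 1 \<Longrightarrow> x z * f z + y z * g z = 1"
    using real_disc_algebra_corona[OF f g nz] by blast
  obtain B where B: "B > 0" "\<And>z. z \<in> cball 0 1 \<Longrightarrow> cmod (x z) \<le> B"
    using disc_algebra_bounded[OF real_disc_algebra_imp_disc_algebra[OF x]] by blast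
  \<comment> \<open>Where \<open>g\<close> vanishes, \<open>\<delta> \<le> cmod (f z)\<close>, so an
    error below \<open>\<delta>\<close> keeps \<open>p\<close> nonzero there and positive at the
    real zeros; an error below \<open>1 / B\<close> permits \<open>unit_mod_perturb\<close>.\<close>
  obtain p where p: "real_poly p" "\<And>z. z \<in> cball 0 1 \<Longrightarrow> cmod (poly p z - f z) < min \<delta> (1 / B)"
    using real_disc_algebra_poly_approx[OF f, of "min \<delta> (1 / B)"] \<open>\<delta> > 0\<close> B(1) by auto
  have "unit_mod g (poly p)"
  proof (rule unit_mod_real_poly[OF g p(1)])
    show "poly p z \<noteq> 0" if "z \<in> cball 0 1" "g z = 0" for z
      using p(2)[OF that(1)] \<delta>[OF that(1)] that(2) by auto
    show "Re (poly p (of_real t)) > 0" if t: "-1 \<le> t" "t \<le> 1" "g (of_real t) = 0" for t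
    proof -
      have tc: "complex_of_real t \<in> cball 0 1" using t by (auto simp: abs_le_iff)
      have "\<delta> \<le> cmod (f (of_real t))"
        using \<delta>[OF tc] t(3) by simp
      also have "\<dots> = Re (f (of_real t))"
        using pos[OF t] real_disc_algebra_real_value[OF f t(1,2)] by (metis abs_of_pos norm_of_real)
      finally have "\<delta> \<le> Re (f (of_real t))" .
      moreover have "cmod (poly p (of_real t) - f (of_real t)) < \<delta>"
        using p(2)[OF tc] by simp
      moreover have "\<bar>Re (poly p (of_real t)) - Re (f (of_real t))\<bar> \<le> cmod (poly p (of_real t) - f (of_real t))"
        using abs_Re_le_cmod[of "poly p (of_real t) - f (of_real t)"] by simp
      ultimately show ?thesis by linarith
    qed
  qed
  moreover have "cmod (x z * (poly p z - f z)) < 1" if "z \<in> cball 0 1" for z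
  proof -
    have "cmod (x z * (poly p z - f z)) \<le> B * cmod (poly p z - f z)"
      unfolding norm_mult using B(2)[OF that] by (rule mult_right_mono) simp
    also have "\<dots> < B * (1 / B)"
      using p(2)[OF that] B(1) by (intro mult_strict_left_mono) auto
    finally show ?thesis using B(1) by simp
  qed
  ultimately show ?thesis
    using unit_mod_perturb[OF g f real_poly_real_disc_algebra[OF p(1)] x y xy] by blast
qed

lemma bezout_if_unit_mod:
  assumes f: "f \<in> real_disc_algebra" and g: "g \<in> real_disc_algebra" and "unit_mod g f"
  shows "\<exists>g1 g2. g1 \<in> real_disc_algebra \<and> g2 \<in> real_disc_algebra \<and>
           (\<lambda>z. inverse (g1 z)) \<in> real_disc_algebra \<and> (\<forall>z\<in>cball 0 1. g1 z \<noteq> 0) \<and>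
           (\<forall>z\<in>cball 0 1. f z * g1 z + g z * g2 z = 1)"
proof -
  obtain u h where u: "u \<in> real_disc_algebra" "h \<in> real_disc_algebra"
    and nz: "\<And>z. z \<in> cball 0 1 \<Longrightarrow> u z \<noteq> 0" and eq: "\<And>z. z \<in> cball 0 1 \<Longrightarrow> f z = u z + h z * g z"
    using unit_modE[OF assms(3)] by metis
  show ?thesis
  proof (intro exI conjI ballI)
    show "(\<lambda>z. 1 / u z) \<in> real_disc_algebra" "(\<lambda>z. - h z / u z) \<in> real_disc_algebra"
      using nz by (intro real_disc_algebra_intros u; simp)+
    show "(\<lambda>z. inverse (1 / u z)) \<in> real_disc_algebra" using u(1) by simp
    show "1 / u z \<noteq> 0" if "z \<in> cball 0 1" for z using nz[OF that] by simp
    show "f z * (1 / u z) + g z * (- h z / u z) = 1" if "z \<in> cball 0 1" for z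
      using nz[OF that] unfolding eq[OF that] by (simp add: field_simps)
  qed
qed

theorem theorem1p2:
  fixes f1 f2 :: "complex \<Rightarrow> complex" and \<delta> :: real
  assumes "f1 \<in> real_disc_algebra" and "f2 \<in> real_disc_algebra"
    and "sup_norm_disc f1 \<le> 1" and "sup_norm_disc f2 \<le> 1"
    and "POZ f1 f2"
    and "(INF z\<in>cball 0 1. cmod (f1 z) + cmod (f2 z)) = \<delta>" and "\<delta> > 0"
  shows "\<exists>g1 g2. g1 \<in> real_disc_algebra \<and> g2 \<in> real_disc_algebra \<and>
           (\<lambda>z. inverse (g1 z)) \<in> real_disc_algebra \<and> (\<forall>z\<in>cball 0 1. g1 z \<noteq> 0) \<and>
           (\<forall>z\<in>cball 0 1. f1 z * g1 z + f2 z * g2 z = 1)"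
proof -
  have "bdd_below ((\<lambda>z. cmod (f1 z) + cmod (f2 z)) ` cball 0 1)"
    by (rule bdd_belowI2[of _ 0]) simp
  then have \<delta>: "\<delta> \<le> cmod (f1 z) + cmod (f2 z)" if "z \<in> cball 0 1" for z
    unfolding assms(6)[symmetric] using that by (rule cINF_lower)
  have "unit_mod f2 f1"
    using \<open>POZ f1 f2\<close> unfolding POZ_def
  proof
    assume "\<forall>t. -1 \<le> t \<and> t \<le> 1 \<and> f2 (complex_of_real t) = 0 \<longrightarrow> Re (f1 (complex_of_real t)) > 0"
    then show ?thesis
      using \<delta> by (intro unit_mod_if_positive_on_real_zeros[OF assms(1,2) \<open>\<delta> > 0\<close>]) auto
  next
    assume "\<forall>t. -1 \<le> t \<and> t \<le> 1 \<and> f2 (complex_of_real t) = 0 \<longrightarrow> Re (f1 (complex_of_real t)) < 0"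
    then have "unit_mod f2 (\<lambda>z. - f1 z)"
      using \<delta> by (intro unit_mod_if_positive_on_real_zeros[OF real_disc_algebra_uminus[OF assms(1)] assms(2) \<open>\<delta> > 0\<close>]) auto
    \<comment> \<open>The negative case reduces to the positive one, as the constant
      \<open>-1\<close> is a unit.\<close>
    then have "unit_mod f2 (\<lambda>z. -1 * - f1 z)"
      by (rule unit_mod_mult[OF assms(2) unit_mod_unit[OF real_disc_algebra_const], rotated 2]) auto
    then show ?thesis by simp
  qed
  then show ?thesis
    by (rule bezout_if_unit_mod[OF assms(1,2)])
qed

end
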